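(* For every $k\in\mathbb Z$ there exists $C_k>0$ such that for all $t\in\mathbb R$, $|\Lambda_k(t)|+|t^3\Lambda_k'(t)|+|t^4\Lambda_k''(t)|+|t^5\Lambda_k'''(t)|\le C_k$.
   Context: Let $M(a,b,\zeta)=\sum_{n\ge0}\frac{(a)_n}{(b)_n}\frac{\zeta^n}{n!}$ be Kummer's function. For $k\in\mathbb Z$ define $$\Lambda_k(t)=9^{\frac16+k}(1+t^2)^{-\frac14-\frac{3k}2}\Big[\tfrac{\Gamma(1/3)}{\Gamma(1/6-k)}M\big(-\tfrac16-k,\tfrac23,-\tfrac{t^3}{9}\big)-\tfrac{t}{9^{1/3}}\tfrac{\Gamma(-1/3)}{\Gamma(-1/6-k)}M\big(\tfrac16-k,\tfrac43,-\tfrac{t^3}{9}\big)\Big].$$ *)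

theory Defs
  imports "HOL-Analysis.Analysis"
begin

definition kummerM :: "real \<Rightarrow> real \<Rightarrow> real \<Rightarrow> real" where
  "kummerM a b z = (\<Sum>n. pochhammer a n / pochhammer b n * z ^ n / fact n)"

definition Lambda :: "int \<Rightarrow> real \<Rightarrow> real" where
  "Lambda k t = 9 powr (1/6 + real_of_int k) * (1 + t^2) powr (-1/4 - 3 * real_of_int k / 2) *
     (Gamma (1/3) / Gamma (1/6 - real_of_int k) * kummerM (-1/6 - real_of_int k) (2/3) (-(t^3) / 9)
      - t / 9 powr (1/3) * (Gamma (-1/3) / Gamma (-1/6 - real_of_int k))
          * kummerM (1/6 - real_of_int k) (4/3) (-(t^3) / 9))"

end

theory Submission
  imports Defs "HOL-Real_Asymp.Real_Asymp"
begin

text \<open>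
  With \<open>a = -1/6 - k\<close>, the function \<open>\<Lambda>\<^sub>k\<close> is a constant multiple of \<open>(1 + t\<^sup>2) powr (3a/2) U\<^sub>a\<close>, where
  \<open>U\<^sub>a(t)\<close> is Tricomi's function \<open>U(a, 2/3, -t\<^sup>3/9)\<close>.  Put \<open>\<kappa> = a (a + 1/3)\<close>.  The contiguous relations
  \<open>t U\<^sub>a' = 3\<kappa> U\<^sub>a\<^sub>+\<^sub>1 - 3a U\<^sub>a\<close> and \<open>t U\<^sub>a\<^sub>+\<^sub>1' = (3a + 1 - t\<^sup>3/3) U\<^sub>a\<^sub>+\<^sub>1 - 3 U\<^sub>a\<close> together with
  \<open>U\<^sub>a'' = -\<kappa> t U\<^sub>a\<^sub>+\<^sub>1\<close> reduce everything to the bound \<open>U\<^sub>a = O(\<bar>t\<bar> powr (-3a))\<close> at both ends for \<open>a > 0\<close>.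
  At \<open>+\<infinity>\<close> it holds for every solution of the system, since
  \<open>t powr (6a) (\<kappa> U\<^sub>a\<^sub>+\<^sub>1\<^sup>2 + U\<^sub>a\<^sup>2)\<close> eventually decreases.  At \<open>-\<infinity>\<close> generic solutions grow like
  \<open>exp (\<bar>t\<bar>\<^sup>3/9)\<close>, but \<open>\<Gamma>(a) U\<^sub>a(-x)\<close> has the same initial values at \<open>0\<close> as the Laplace integral
  \<open>\<integral> exp (-zs) s powr (a-1) (1+s) powr (-a-1/3) ds\<close> over \<open>s > 0\<close> at \<open>z = x\<^sup>3/9\<close>, hence equals it,
  and this integral is at most \<open>\<Gamma>(a) z powr (-a)\<close>.  Thus \<open>U\<^sub>a\<close> is a symbol of order \<open>-3a\<close>, for \<open>a > 0\<close>
  by the formula for \<open>U\<^sub>a''\<close> and for other \<open>a\<close> by the second relation.  Finally, in \<open>t \<Lambda>\<^sub>k'\<close> the leading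
  terms cancel, so that \<open>\<Lambda>\<^sub>k'\<close> has order \<open>-3\<close> instead of \<open>-1\<close>.
\<close>

section \<open>Kummer's function and its contiguous relations\<close>

lemma pos_not_nonpos_Ints:
  fixes x :: "'a :: linordered_idom"
  shows "x > 0 \<Longrightarrow> x \<notin> \<int>\<^sub>\<le>\<^sub>0"
  using nonpos_Ints_nonpos[of x] by auto

definition kummer_coeff :: "real \<Rightarrow> real \<Rightarrow> nat \<Rightarrow> real" where
  "kummer_coeff a b n = pochhammer a n / (pochhammer b n * fact n)"

lemma kummer_coeff_Suc:
  "kummer_coeff a b (Suc n) = (a + n) / ((b + n) * (1 + n)) * kummer_coeff a b n"
  by (simp add: kummer_coeff_def pochhammer_Suc mult_ac)

lemma kummer_coeff_Suc_shift:
  "real (Suc n) * kummer_coeff a b (Suc n) = a / b * kummer_coeff (a + 1) (b + 1) n"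
  by (simp add: kummer_coeff_def pochhammer_rec divide_simps)

lemma kummer_coeff_raise_a: "(a + n) * kummer_coeff a b n = a * kummer_coeff (a + 1) b n"
proof -
  have "(a + n) * pochhammer a n = a * pochhammer (a + 1) n"
    using pochhammer_Suc[of a n] pochhammer_rec[of a n] by (simp add: mult.commute)
  then show ?thesis by (simp add: kummer_coeff_def)
qed

lemma kummer_coeff_raise_b:
  assumes "b \<notin> \<int>\<^sub>\<le>\<^sub>0"
  shows "(b + n) * kummer_coeff a (b + 1) n = b * kummer_coeff a b n"
proof -
  have "(b + n) * pochhammer b n = b * pochhammer (b + 1) n"
    using pochhammer_Suc[of b n] pochhammer_rec[of b n] by (simp add: mult.commute)
  moreover have "pochhammer b n \<noteq> 0" "pochhammer (b + 1) n \<noteq> 0"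
    using assms plus_one_in_nonpos_Ints_imp[of b] by (auto simp: pochhammer_eq_0_iff)
  ultimately have "(b + n) / pochhammer (b + 1) n = b / pochhammer b n"
    by (simp add: field_simps)
  from arg_cong[OF this, of "\<lambda>x. x * (pochhammer a n / fact n)"]
  show ?thesis by (simp add: kummer_coeff_def)
qed

lemma kummer_coeff_lower_a:
  assumes "b \<notin> \<int>\<^sub>\<le>\<^sub>0"
  shows "real (Suc n) * kummer_coeff (a + 1) b (Suc n) =
    (b - a - 1) * kummer_coeff a b (Suc n) + (a + 1 - b) * kummer_coeff (a + 1) b (Suc n)
      + kummer_coeff (a + 1) b n"
proof -
  define q where "q = kummer_coeff (a + 1) b n / ((b + n) * (1 + n))"
  have "b + n \<noteq> 0" "1 + real n \<noteq> 0"
    using assms by (auto simp: add_eq_0_iff2)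
  then have "kummer_coeff (a + 1) b n = (b + n) * (1 + n) * q"
    by (simp add: q_def)
  moreover have "kummer_coeff (a + 1) b (Suc n) = (a + 1 + n) * q"
    by (simp add: q_def kummer_coeff_Suc)
  moreover have "kummer_coeff a b (Suc n) = a * q"
    using kummer_coeff_raise_a[of a n b] by (simp add: q_def kummer_coeff_Suc)
  ultimately show ?thesis by (simp add: algebra_simps)
qed

lemma summable_kummer_coeff: "summable (\<lambda>n. kummer_coeff a b n * z ^ n)"
proof -
  define r where "r n = \<bar>(a + real n) / ((b + real n) * (1 + real n)) * z\<bar>" for n
  have "(\<lambda>n. (a + real n) / ((b + real n) * (1 + real n)) * z) \<longlonglongrightarrow> 0"
    by real_asymp
  then have "r \<longlonglongrightarrow> 0"
    unfolding r_def by (rule tendsto_rabs_zero)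
  then have "eventually (\<lambda>n. r n < 1/2) sequentially"
    by (rule order_tendstoD) simp
  then obtain N where N: "\<And>n. n \<ge> N \<Longrightarrow> r n < 1/2"
    by (auto simp: eventually_sequentially)
  show ?thesis
  proof (rule summable_ratio_test)
    fix n assume "n \<ge> N"
    have "norm (kummer_coeff a b (Suc n) * z ^ Suc n) = r n * norm (kummer_coeff a b n * z ^ n)"
      by (simp add: kummer_coeff_Suc r_def abs_mult mult_ac)
    also have "\<dots> \<le> 1/2 * norm (kummer_coeff a b n * z ^ n)"
      using N[OF \<open>n \<ge> N\<close>] by (intro mult_right_mono) auto
    finally show "norm (kummer_coeff a b (Suc n) * z ^ Suc n)
        \<le> 1/2 * norm (kummer_coeff a b n * z ^ n)" .
  qed simp
qed

lemma kummerM_sums: "(\<lambda>n. kummer_coeff a b n * z ^ n) sums kummerM a b z"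
  using summable_sums[OF summable_kummer_coeff[of a b z]]
  by (simp add: kummerM_def kummer_coeff_def field_simps)

lemma has_real_derivative_kummerM:
  "(kummerM a b has_real_derivative a / b * kummerM (a + 1) (b + 1) z) (at z)"
proof -
  have diffs: "diffs (kummer_coeff a b) n = a / b * kummer_coeff (a + 1) (b + 1) n" for n
    unfolding diffs_def by (rule kummer_coeff_Suc_shift)
  have "((\<lambda>z. \<Sum>n. kummer_coeff a b n * z ^ n) has_real_derivative
      (\<Sum>n. diffs (kummer_coeff a b) n * z ^ n)) (at z)"
    by (rule termdiffs_strong_converges_everywhere) (rule summable_kummer_coeff)
  moreover have "(\<lambda>z. \<Sum>n. kummer_coeff a b n * z ^ n) = kummerM a b"
    using kummerM_sums by (auto simp: sums_iff)
  moreover have "(\<Sum>n. diffs (kummer_coeff a b) n * z ^ n) = a / b * kummerM (a + 1) (b + 1) z"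
    using sums_mult[OF kummerM_sums, of "a / b"] by (simp add: diffs sums_iff mult.assoc)
  ultimately show ?thesis by simp
qed

lemma deriv_kummerM: "deriv (kummerM a b) z = a / b * kummerM (a + 1) (b + 1) z"
  by (rule DERIV_imp_deriv) (rule has_real_derivative_kummerM)

lemma kummerM_euler_sums:
  "(\<lambda>n. real n * kummer_coeff a b n * z ^ n) sums (z * deriv (kummerM a b) z)"
proof -
  have "(\<lambda>n. z * (a / b * (kummer_coeff (a + 1) (b + 1) n * z ^ n))) sums
      (z * (a / b * kummerM (a + 1) (b + 1) z))"
    by (intro sums_mult kummerM_sums)
  also have "(\<lambda>n. z * (a / b * (kummer_coeff (a + 1) (b + 1) n * z ^ n))) =
      (\<lambda>n. real (Suc n) * kummer_coeff a b (Suc n) * z ^ Suc n)"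
    unfolding kummer_coeff_Suc_shift by (simp add: mult_ac)
  finally show ?thesis by (subst (asm) sums_Suc_iff) (simp add: deriv_kummerM)
qed

lemma kummerM_raise_a:
  "z * deriv (kummerM a b) z = a * (kummerM (a + 1) b z - kummerM a b z)"
proof -
  have "(\<lambda>n. a * (kummer_coeff (a + 1) b n * z ^ n) - a * (kummer_coeff a b n * z ^ n)) sums
      (a * kummerM (a + 1) b z - a * kummerM a b z)"
    by (intro sums_diff sums_mult kummerM_sums)
  also have "(\<lambda>n. a * (kummer_coeff (a + 1) b n * z ^ n) - a * (kummer_coeff a b n * z ^ n)) =
      (\<lambda>n. real n * kummer_coeff a b n * z ^ n)"
  proof
    fix n
    show "a * (kummer_coeff (a + 1) b n * z ^ n) - a * (kummer_coeff a b n * z ^ n) =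
        real n * kummer_coeff a b n * z ^ n"
      using arg_cong[OF kummer_coeff_raise_a[of a n b], of "\<lambda>c. c * z ^ n"]
      by (simp add: algebra_simps)
  qed
  finally show ?thesis
    using sums_unique2[OF kummerM_euler_sums] by (simp add: right_diff_distrib)
qed

lemma kummerM_lower_b:
  assumes "b \<notin> \<int>\<^sub>\<le>\<^sub>0"
  shows "z * deriv (kummerM a (b + 1)) z = b * (kummerM a b z - kummerM a (b + 1) z)"
proof -
  have "(\<lambda>n. b * (kummer_coeff a b n * z ^ n) - b * (kummer_coeff a (b + 1) n * z ^ n)) sums
      (b * kummerM a b z - b * kummerM a (b + 1) z)"
    by (intro sums_diff sums_mult kummerM_sums)
  also have "(\<lambda>n. b * (kummer_coeff a b n * z ^ n) - b * (kummer_coeff a (b + 1) n * z ^ n)) =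
      (\<lambda>n. real n * kummer_coeff a (b + 1) n * z ^ n)"
  proof
    fix n
    show "b * (kummer_coeff a b n * z ^ n) - b * (kummer_coeff a (b + 1) n * z ^ n) =
        real n * kummer_coeff a (b + 1) n * z ^ n"
      using arg_cong[OF kummer_coeff_raise_b[OF assms, of n a], of "\<lambda>c. c * z ^ n"]
      by (simp add: algebra_simps)
  qed
  finally show ?thesis
    using sums_unique2[OF kummerM_euler_sums] by (simp add: right_diff_distrib)
qed

lemma kummerM_lower_a:
  assumes "b \<notin> \<int>\<^sub>\<le>\<^sub>0"
  shows "z * deriv (kummerM (a + 1) b) z =
    (b - a - 1) * kummerM a b z + (a + 1 - b + z) * kummerM (a + 1) b z"
proof -
  let ?s = "\<lambda>n. real n * kummer_coeff (a + 1) b n * z ^ n -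
      ((b - a - 1) * (kummer_coeff a b n * z ^ n)
      + (a + 1 - b) * (kummer_coeff (a + 1) b n * z ^ n))"
  have "?s sums (z * deriv (kummerM (a + 1) b) z
      - ((b - a - 1) * kummerM a b z + (a + 1 - b) * kummerM (a + 1) b z))"
    by (intro sums_diff sums_add sums_mult kummerM_sums kummerM_euler_sums)
  moreover have "(\<lambda>n. ?s (Suc n)) sums (z * kummerM (a + 1) b z)"
  proof -
    have "?s (Suc n) = z * (kummer_coeff (a + 1) b n * z ^ n)" for n
      unfolding kummer_coeff_lower_a[OF assms] by (simp add: algebra_simps)
    then show ?thesis using sums_mult[OF kummerM_sums] by simp
  qed
  then have "?s sums (z * kummerM (a + 1) b z)"
    by (subst (asm) sums_Suc_iff) (simp add: kummer_coeff_def)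
  ultimately have "z * deriv (kummerM (a + 1) b) z
      - ((b - a - 1) * kummerM a b z + (a + 1 - b) * kummerM (a + 1) b z) = z * kummerM (a + 1) b z"
    by (rule sums_unique2)
  then show ?thesis by (simp add: algebra_simps)
qed

section \<open>Tricomi's function at a cube\<close>

lemma has_real_derivative_kummerM_cube:
  "((\<lambda>t. kummerM a b (- (t ^ 3) / 9)) has_real_derivative
    - (t\<^sup>2 / 3) * deriv (kummerM a b) (- (t ^ 3) / 9)) (at t)"
proof -
  have "((\<lambda>t::real. - (t ^ 3) / 9) has_real_derivative - (t\<^sup>2 / 3)) (at t)"
    by (auto intro!: derivative_eq_intros)
  from DERIV_chain2[OF has_real_derivative_kummerM this] show ?thesis
    by (simp add: deriv_kummerM mult_ac)
qed

lemma has_real_derivative_power_kummerM_cube: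
  assumes "m > 0"
  shows "((\<lambda>t. t ^ m * kummerM a (m / 3 + 1) (- (t ^ 3) / 9)) has_real_derivative
    m * t ^ (m - 1) * kummerM a (m / 3) (- (t ^ 3) / 9)) (at t)"
proof -
  define z where "z = - (t ^ 3) / 9"
  have not_nonpos: "real m / 3 \<notin> \<int>\<^sub>\<le>\<^sub>0"
    using assms by (simp add: pos_not_nonpos_Ints)
  have "t ^ m = t ^ (m - 1) * t"
    using assms by (metis power_minus_mult)
  then have "t ^ m * (- (t\<^sup>2 / 3) * deriv (kummerM a (m / 3 + 1)) z)
      = 3 * t ^ (m - 1) * (z * deriv (kummerM a (m / 3 + 1)) z)"
    by (simp add: z_def power2_eq_square power3_eq_cube)
  also have "\<dots> = m * t ^ (m - 1) * (kummerM a (m / 3) z - kummerM a (m / 3 + 1) z)"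
    by (subst kummerM_lower_b[OF not_nonpos]) simp
  finally have "m * t ^ (m - 1) * kummerM a (m / 3 + 1) z
      + t ^ m * (- (t\<^sup>2 / 3) * deriv (kummerM a (m / 3 + 1)) z)
      = m * t ^ (m - 1) * kummerM a (m / 3) z"
    by (simp add: right_diff_distrib)
  then show ?thesis
    using DERIV_mult[OF DERIV_pow[of m t UNIV] has_real_derivative_kummerM_cube[of a "m / 3 + 1" t]]
    by (simp add: z_def mult.commute add.commute)
qed

text \<open>The solutions of \<open>u'' + t\<^sup>2 u' / 3 + a t u = 0\<close> with initial values \<open>(1, 0)\<close> and \<open>(0, 1)\<close> at \<open>0\<close>.\<close>

definition kummerP :: "real \<Rightarrow> real \<Rightarrow> real" where
  "kummerP a t = kummerM a (2/3) (- (t ^ 3) / 9)"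

definition kummerQ :: "real \<Rightarrow> real \<Rightarrow> real" where
  "kummerQ a t = t * kummerM (a + 1/3) (4/3) (- (t ^ 3) / 9)"

lemma has_real_derivative_kummerP:
  "(kummerP a has_real_derivative - (a / 2) * (t\<^sup>2 * kummerM (a + 1) (5/3) (- (t ^ 3) / 9))) (at t)"
  using has_real_derivative_kummerM_cube[of a "2/3" t]
  by (simp add: kummerP_def[abs_def] deriv_kummerM mult_ac)

lemma has_real_derivative_kummerQ:
  "(kummerQ a has_real_derivative kummerM (a + 1/3) (1/3) (- (t ^ 3) / 9)) (at t)"
  using has_real_derivative_power_kummerM_cube[of 1 "a + 1/3" t]
  by (simp add: kummerQ_def[abs_def])

lemma deriv_kummerP:
  "deriv (kummerP a) = (\<lambda>t. - (a / 2) * (t\<^sup>2 * kummerM (a + 1) (5/3) (- (t ^ 3) / 9)))"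
  by (intro ext DERIV_imp_deriv has_real_derivative_kummerP)

lemma deriv_kummerQ: "deriv (kummerQ a) = (\<lambda>t. kummerM (a + 1/3) (1/3) (- (t ^ 3) / 9))"
  by (intro ext DERIV_imp_deriv has_real_derivative_kummerQ)

lemma has_real_derivative_deriv_kummerP:
  "(deriv (kummerP a) has_real_derivative - a * t * kummerP (a + 1) t) (at t)"
  using DERIV_cmult[OF has_real_derivative_power_kummerM_cube[of 2 "a + 1" t], of "- (a / 2)"]
  by (simp add: deriv_kummerP kummerP_def mult_ac)

lemma has_real_derivative_deriv_kummerQ:
  "(deriv (kummerQ a) has_real_derivative - (a + 1/3) * t * kummerQ (a + 1) t) (at t)"
  unfolding deriv_kummerQ
  by (rule DERIV_cong[OF has_real_derivative_kummerM_cube])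
     (simp add: kummerQ_def deriv_kummerM power2_eq_square algebra_simps)

lemma euler_kummerP:
  "t * deriv (kummerP a) t =
    3 * (- (t ^ 3) / 9 * deriv (kummerM a (2/3)) (- (t ^ 3) / 9))"
  using DERIV_imp_deriv[OF has_real_derivative_kummerM_cube[of a "2/3" t]]
  by (simp add: kummerP_def[abs_def] power2_eq_square power3_eq_cube)

lemma euler_kummerQ:
  "t * deriv (kummerQ a) t =
    kummerQ a t + 3 * t * (- (t ^ 3) / 9 * deriv (kummerM (a + 1/3) (4/3)) (- (t ^ 3) / 9))"
proof -
  have "(1/3::real) \<notin> \<int>\<^sub>\<le>\<^sub>0" by (simp add: pos_not_nonpos_Ints)
  from kummerM_lower_b[OF this, of "- (t ^ 3) / 9" "a + 1/3"] show ?thesis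
    by (simp add: deriv_kummerQ kummerQ_def algebra_simps)
qed

lemma kummerP_raise: "t * deriv (kummerP a) t = 3 * a * (kummerP (a + 1) t - kummerP a t)"
  unfolding euler_kummerP kummerM_raise_a by (simp add: kummerP_def)

lemma kummerQ_raise:
  "t * deriv (kummerQ a) t = (3 * a + 1) * kummerQ (a + 1) t - 3 * a * kummerQ a t"
  unfolding euler_kummerQ kummerM_raise_a by (simp add: kummerQ_def algebra_simps)

lemma kummerP_lower:
  "t * deriv (kummerP (a + 1)) t =
    (3 * a + 1 - t ^ 3 / 3) * kummerP (a + 1) t - (3 * a + 1) * kummerP a t"
proof -
  have "(2/3::real) \<notin> \<int>\<^sub>\<le>\<^sub>0" by (simp add: pos_not_nonpos_Ints)
  from kummerM_lower_a[OF this, of "- (t ^ 3) / 9" a] show ?thesis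
    unfolding euler_kummerP by (simp add: kummerP_def algebra_simps)
qed

lemma kummerQ_lower:
  "t * deriv (kummerQ (a + 1)) t =
    (3 * a + 1 - t ^ 3 / 3) * kummerQ (a + 1) t - 3 * a * kummerQ a t"
proof -
  define z where "z = - (t ^ 3) / 9"
  have "(4/3::real) \<notin> \<int>\<^sub>\<le>\<^sub>0" by (simp add: pos_not_nonpos_Ints)
  then have lower: "z * deriv (kummerM (a + 1 + 1/3) (4/3)) z =
      - a * kummerM (a + 1/3) (4/3) z + (a + z) * kummerM (a + 1 + 1/3) (4/3) z"
    using kummerM_lower_a[of "4/3" z "a + 1/3"] by (simp add: add_ac)
  show ?thesis
    unfolding euler_kummerQ kummerQ_def z_def[symmetric] lower
    by (simp add: z_def algebra_simps)
qed

text \<open>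
  \<open>kummerU a t\<close> is Tricomi's function \<open>U(a, 2/3, z)\<close> at \<open>z = - t\<^sup>3 / 9\<close>, continued through the
  branch point \<open>z = 0\<close>.  With the reciprocal Gamma function its recurrences hold for all \<open>a\<close>.
\<close>

definition kummerU_init :: "real \<Rightarrow> real" where
  "kummerU_init a = Gamma (1/3) * rGamma (a + 1/3)"

definition kummerU_slope :: "real \<Rightarrow> real" where
  "kummerU_slope a = - (Gamma (-1/3) / 9 powr (1/3) * rGamma a)"

definition kummerU :: "real \<Rightarrow> real \<Rightarrow> real" where
  "kummerU a t = kummerU_init a * kummerP a t + kummerU_slope a * kummerQ a t"

lemma kummerU_init_rec: "kummerU_init a = (a + 1/3) * kummerU_init (a + 1)"
  using rGamma_plus1[of "a + 1/3"] by (simp add: kummerU_init_def add_ac mult_ac)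

lemma kummerU_slope_rec: "kummerU_slope a = a * kummerU_slope (a + 1)"
  using rGamma_plus1[of a] by (simp add: kummerU_slope_def mult_ac)

lemma has_real_derivative_kummerU_kummerPQ:
  "(kummerU a has_real_derivative
    kummerU_init a * deriv (kummerP a) t + kummerU_slope a * deriv (kummerQ a) t) (at t)"
  unfolding kummerU_def[abs_def] deriv_kummerP deriv_kummerQ
  by (intro DERIV_add DERIV_cmult has_real_derivative_kummerP has_real_derivative_kummerQ)

lemma deriv_kummerU:
  "deriv (kummerU a) =
    (\<lambda>t. kummerU_init a * deriv (kummerP a) t + kummerU_slope a * deriv (kummerQ a) t)"
  by (intro ext DERIV_imp_deriv has_real_derivative_kummerU_kummerPQ)

lemma has_real_derivative_kummerU: "(kummerU a has_real_derivative deriv (kummerU a) t) (at t)"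
  unfolding deriv_kummerU by (rule has_real_derivative_kummerU_kummerPQ)

lemma has_real_derivative_deriv_kummerU:
  "(deriv (kummerU a) has_real_derivative - (a * (a + 1/3)) * t * kummerU (a + 1) t) (at t)"
proof -
  have "(deriv (kummerU a) has_real_derivative
      kummerU_init a * (- a * t * kummerP (a + 1) t)
      + kummerU_slope a * (- (a + 1/3) * t * kummerQ (a + 1) t)) (at t)"
    unfolding deriv_kummerU
    by (intro DERIV_add DERIV_cmult has_real_derivative_deriv_kummerP
        has_real_derivative_deriv_kummerQ)
  then show ?thesis
    by (rule DERIV_cong)
       (simp add: kummerU_def kummerU_init_rec[of a] kummerU_slope_rec[of a] algebra_simps)
qed

lemma kummerU_raise:
  "t * deriv (kummerU a) t = 3 * (a * (a + 1/3)) * kummerU (a + 1) t - 3 * a * kummerU a t"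
proof -
  have "t * deriv (kummerU a) t =
      kummerU_init a * (t * deriv (kummerP a) t) + kummerU_slope a * (t * deriv (kummerQ a) t)"
    by (simp add: deriv_kummerU algebra_simps)
  also have "\<dots> = 3 * (a * (a + 1/3)) * kummerU (a + 1) t - 3 * a * kummerU a t"
    unfolding kummerP_raise kummerQ_raise
    by (simp add: kummerU_def kummerU_init_rec[of a] kummerU_slope_rec[of a] algebra_simps)
  finally show ?thesis .
qed

lemma kummerU_lower:
  "t * deriv (kummerU (a + 1)) t = (3 * a + 1 - t ^ 3 / 3) * kummerU (a + 1) t - 3 * kummerU a t"
proof -
  have "t * deriv (kummerU (a + 1)) t =
      kummerU_init (a + 1) * (t * deriv (kummerP (a + 1)) t)
      + kummerU_slope (a + 1) * (t * deriv (kummerQ (a + 1)) t)"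
    by (simp add: deriv_kummerU algebra_simps)
  also have "\<dots> = (3 * a + 1 - t ^ 3 / 3) * kummerU (a + 1) t - 3 * kummerU a t"
    unfolding kummerP_lower kummerQ_lower
    by (simp add: kummerU_def kummerU_init_rec[of a] kummerU_slope_rec[of a] algebra_simps)
  finally show ?thesis .
qed

section \<open>Laplace integrals over a half-line\<close>

lemma dominated_convergence_at:
  fixes f :: "'a::first_countable_topology \<Rightarrow> 'n::euclidean_space \<Rightarrow> 'm::euclidean_space"
  assumes f: "\<And>y. y \<in> A - {x} \<Longrightarrow> f y integrable_on S" and h: "h integrable_on S"
    and le: "\<And>y s. y \<in> A - {x} \<Longrightarrow> s \<in> S \<Longrightarrow> norm (f y s) \<le> h s"
    and conv: "\<And>s. s \<in> S \<Longrightarrow> ((\<lambda>y. f y s) \<longlongrightarrow> g s) (at x within A)"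
  shows "((\<lambda>y. integral S (f y)) \<longlongrightarrow> integral S g) (at x within A)"
  unfolding tendsto_at_iff_sequentially comp_def
proof (intro allI impI)
  fix X assume X: "\<forall>i. X i \<in> A - {x}" "X \<longlonglongrightarrow> x"
  show "(\<lambda>i. integral S (f (X i))) \<longlonglongrightarrow> integral S g"
  proof (rule dominated_convergence(2)[where h = h])
    show "(\<lambda>i. f (X i) s) \<longlonglongrightarrow> g s" if "s \<in> S" for s
      using conv[OF that] X unfolding tendsto_at_iff_sequentially comp_def by blast
  qed (use X f h le in auto)
qed

lemma has_integral_change_of_variables_nonneg:
  fixes f g :: "real \<Rightarrow> real"
  assumes S: "S \<in> sets lebesgue"
    and der: "\<And>x. x \<in> S \<Longrightarrow> (g has_field_derivative g' x) (at x within S)"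
    and inj: "inj_on g S" and nonneg: "\<And>x. x \<in> S \<Longrightarrow> f (g x) \<ge> 0"
  shows "((\<lambda>x. \<bar>g' x\<bar> * f (g x)) has_integral b) S \<longleftrightarrow> (f has_integral b) (g ` S)"
proof -
  have has_integral_iff_abs: "(u has_integral b) T \<longleftrightarrow> u absolutely_integrable_on T \<and> integral T u = b"
    if "\<And>x. x \<in> T \<Longrightarrow> u x \<ge> 0" for u :: "real \<Rightarrow> real" and T
    using nonnegative_absolutely_integrable_1[of u T] that
    by (auto simp: has_integral_iff set_lebesgue_integral_eq_integral(1))
  show ?thesis
    using has_absolute_integral_change_of_variables_1'[OF S der inj, of f b] nonneg
    by (subst (1 2) has_integral_iff_abs) auto
qed

lemma has_integral_scale_halfline:
  fixes f :: "real \<Rightarrow> real"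
  assumes "(f has_integral I) {0<..}" "c > 0" and nonneg: "\<And>s. s > 0 \<Longrightarrow> f s \<ge> 0"
  shows "((\<lambda>s. f (c * s)) has_integral I / c) {0<..}"
proof -
  have image_eq: "(\<lambda>s. c * s) ` {0<..} = {0<..}"
  proof (intro equalityI subsetI)
    fix y :: real assume "y \<in> {0<..}"
    then show "y \<in> (\<lambda>s. c * s) ` {0<..}"
      using assms(2) by (intro image_eqI[of _ _ "y / c"]) auto
  qed (use assms(2) in auto)
  have "((\<lambda>s. \<bar>c\<bar> * f (c * s)) has_integral I) {0<..} \<longleftrightarrow> (f has_integral I) ((\<lambda>s. c * s) ` {0<..})"
    by (rule has_integral_change_of_variables_nonneg)
       (use assms in \<open>auto intro!: derivative_eq_intros inj_onI\<close>)
  then have "((\<lambda>s. \<bar>c\<bar> * f (c * s)) has_integral I) {0<..}"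
    using assms(1) image_eq by simp
  from has_integral_divide[OF this, of c] show ?thesis
    using assms(2) by simp
qed

lemma has_integral_Gamma_scaled:
  fixes p z :: real
  assumes "p > 0" "z > 0"
  shows "((\<lambda>s. exp (- (z * s)) * s powr (p - 1)) has_integral Gamma p * z powr (- p)) {0<..}"
proof -
  have "((\<lambda>t. t powr (p - 1) / exp t) has_integral Gamma p) {0<..}"
    by (subst has_integral_spike_set_eq[of _ "{0..}"])
       (use Gamma_integral_real[OF assms(1)] in \<open>auto intro: negligible_subset[of "{0}"]\<close>)
  from has_integral_scale_halfline[OF this assms(2)]
  have "((\<lambda>s. (z * s) powr (p - 1) / exp (z * s)) has_integral Gamma p / z) {0<..}"
    by simp
  from has_integral_mult_right[OF this, of "z powr (1 - p)"]
  have "((\<lambda>s. z powr (1 - p) * ((z * s) powr (p - 1) / exp (z * s))) has_integral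
      Gamma p * z powr (- p)) {0<..}"
    using assms by (simp add: powr_diff powr_minus field_simps)
  then show ?thesis
  proof (rule has_integral_eq[rotated])
    fix s :: real assume "s \<in> {0<..}"
    then show "z powr (1 - p) * ((z * s) powr (p - 1) / exp (z * s)) =
        exp (- (z * s)) * s powr (p - 1)"
      using assms by (simp add: powr_mult powr_diff exp_minus field_simps)
  qed
qed

lemma has_integral_Beta_halfline:
  fixes p q :: real
  assumes "p > 0" "q > 0"
  shows "((\<lambda>s. s powr (p - 1) * (1 + s) powr (- (p + q))) has_integral Beta p q) {0<..}"
proof -
  let ?f = "\<lambda>s::real. s powr (p - 1) * (1 + s) powr (- (p + q))"
  let ?g = "\<lambda>v::real. v / (1 - v)"
  let ?h = "\<lambda>v::real. v powr (p - 1) * (1 - v) powr (q - 1)"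
  have image_eq: "?g ` {0<..<1} = {0<..}"
  proof (intro equalityI subsetI)
    fix y :: real assume "y \<in> {0<..}"
    then show "y \<in> ?g ` {0<..<1}"
      by (intro image_eqI[of _ _ "y / (1 + y)"]) (auto simp: field_simps)
  qed (auto simp: field_simps)
  have integrand: "?h v = \<bar>1 / (1 - v)\<^sup>2\<bar> * ?f (?g v)" if "v \<in> {0<..<1}" for v
  proof -
    have v: "0 < v" "v < 1" using that by auto
    have "1 + ?g v = 1 / (1 - v)" using v by (simp add: field_simps)
    then have "?f (?g v) = v powr (p - 1) * (1 - v) powr (- (p - 1)) * (1 - v) powr (p + q)"
      using v by (simp add: powr_divide powr_minus powr_diff powr_add field_simps)
    then have "\<bar>1 / (1 - v)\<^sup>2\<bar> * ?f (?g v) =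
        v powr (p - 1) * ((1 - v) powr (- 2) * (1 - v) powr (- (p - 1)) * (1 - v) powr (p + q))"
      using v by (simp add: powr_minus divide_inverse)
    also have "\<dots> = ?h v" by (simp flip: powr_add)
    finally show ?thesis ..
  qed
  have "(?h has_integral Beta p q) {0<..<1}"
    using has_integral_Beta_real[OF assms] by (simp add: has_integral_Icc_iff_Ioo)
  then have "((\<lambda>v. \<bar>1 / (1 - v)\<^sup>2\<bar> * ?f (?g v)) has_integral Beta p q) {0<..<1}"
    by (rule has_integral_eq[rotated]) (rule integrand)
  also have "?this \<longleftrightarrow> (?f has_integral Beta p q) (?g ` {0<..<1})"
    by (rule has_integral_change_of_variables_nonneg)
       (auto intro!: derivative_eq_intros inj_onI simp: power2_eq_square field_simps)
  finally show ?thesis unfolding image_eq .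
qed

lemma integral_exhaust_halfline:
  fixes f :: "real \<Rightarrow> real"
  assumes f: "f absolutely_integrable_on {0<..}"
    and l: "filterlim l (at_right 0) sequentially" and u: "filterlim u at_top sequentially"
  shows "(\<lambda>n. integral ({l n..u n} \<inter> {0<..}) f) \<longlonglongrightarrow> integral {0<..} f"
proof -
  define g where "g n s = (if s \<in> {l n..u n} then f s else 0)" for n s
  have restrict: "g n integrable_on {0<..} \<and> integral {0<..} (g n) = integral ({l n..u n} \<inter> {0<..}) f"
    for n
  proof -
    have "f absolutely_integrable_on ({l n..u n} \<inter> {0<..})"
      by (rule set_integrable_subset[OF f]) auto
    then have "f integrable_on ({l n..u n} \<inter> {0<..})"
      by (rule set_lebesgue_integral_eq_integral(1))
    then show ?thesis
      unfolding g_def by (simp only: integrable_restrict_Int integral_restrict_Int simp_thms)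
  qed
  have "(\<lambda>n. integral {0<..} (g n)) \<longlonglongrightarrow> integral {0<..} f"
  proof (rule dominated_convergence(2)[where h = "\<lambda>s. \<bar>f s\<bar>"])
    show "g n integrable_on {0<..}" for n using restrict by blast
    show "(\<lambda>s. \<bar>f s\<bar>) integrable_on {0<..}" using f by (simp add: absolutely_integrable_on_def)
    show "norm (g n s) \<le> \<bar>f s\<bar>" for n s by (simp add: g_def)
    fix s :: real assume "s \<in> {0<..}"
    then have "eventually (\<lambda>y. y < s) (at_right 0)"
      by (auto simp: eventually_at_right_field)
    then have "eventually (\<lambda>n. l n < s) sequentially" using l by (rule eventually_compose_filterlim)
    moreover have "eventually (\<lambda>n. s < u n) sequentially"
      using u by (auto simp: filterlim_at_top_dense)
    ultimately have "eventually (\<lambda>n. g n s = f s) sequentially"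
      by eventually_elim (simp add: g_def)
    then show "(\<lambda>n. g n s) \<longlonglongrightarrow> f s" by (rule tendsto_eventually)
  qed
  then show ?thesis using restrict by simp
qed

lemma integral_derivative_halfline:
  fixes F f :: "real \<Rightarrow> real"
  assumes deriv: "\<And>s. s > 0 \<Longrightarrow> (F has_real_derivative f s) (at s)"
    and f: "f absolutely_integrable_on {0<..}"
    and lim: "(F \<longlongrightarrow> A) (at_right 0)" "(F \<longlongrightarrow> B) at_top"
  shows "integral {0<..} f = B - A"
proof -
  define l u where "l n = exp (- real n)" and "u n = exp (real n)" for n
  have l: "filterlim l (at_right 0) sequentially" unfolding l_def by real_asymp
  have u: "filterlim u at_top sequentially" unfolding u_def by real_asymp
  have subset: "{l n..u n} \<subseteq> {0<..}" for n
    using less_le_trans[OF exp_gt_zero] by (auto simp: l_def)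
  have FTC: "integral ({l n..u n} \<inter> {0<..}) f = F (u n) - F (l n)" for n
  proof -
    have "(f has_integral F (u n) - F (l n)) {l n..u n}"
    proof (rule fundamental_theorem_of_calculus)
      fix s assume "s \<in> {l n..u n}"
      then have "(F has_real_derivative f s) (at s)" using subset[of n] by (intro deriv) auto
      then show "(F has_vector_derivative f s) (at s within {l n..u n})"
        by (simp add: has_real_derivative_iff_has_vector_derivative has_vector_derivative_at_within)
    qed (simp add: l_def u_def)
    then show ?thesis using subset[of n] by (simp add: Int_absorb2 integral_unique)
  qed
  have "(\<lambda>n. F (u n) - F (l n)) \<longlonglongrightarrow> B - A"
    by (intro tendsto_diff filterlim_compose[OF lim(2) u] filterlim_compose[OF lim(1) l])
  then show ?thesis
    using integral_exhaust_halfline[OF f l u] unfolding FTC by (rule LIMSEQ_unique[rotated])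
qed

lemma exp_minus_mult_lipschitz:
  fixes c y z s :: real
  assumes "c < y" "c < z" "s \<ge> 0"
  shows "\<bar>exp (- (y * s)) - exp (- (z * s))\<bar> \<le> s * exp (- (c * s)) * \<bar>y - z\<bar>"
  unfolding real_norm_def[symmetric]
proof (rule field_differentiable_bound)
  show "((\<lambda>y. exp (- (y * s))) has_real_derivative - s * exp (- (y * s))) (at y within {c<..})" for y
    by (auto intro!: derivative_eq_intros)
  show "norm (- s * exp (- (x * s))) \<le> s * exp (- (c * s))" if "x \<in> {c<..}" for x
    using that assms(3) by (auto simp: abs_mult intro!: mult_left_mono mult_right_mono)
qed (use assms in auto)

lemma has_real_derivative_laplace_integral:
  fixes w :: "real \<Rightarrow> real"
  assumes z: "c < z"
    and int: "\<And>y. c < y \<Longrightarrow> (\<lambda>s. exp (- (y * s)) * w s) integrable_on {0<..}"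
    and dom: "(\<lambda>s. exp (- (c * s)) * (s * \<bar>w s\<bar>)) integrable_on {0<..}"
  shows "((\<lambda>z. integral {0<..} (\<lambda>s. exp (- (z * s)) * w s)) has_real_derivative
    - integral {0<..} (\<lambda>s. exp (- (z * s)) * (s * w s))) (at z)"
proof -
  define L where "L y = integral {0<..} (\<lambda>s. exp (- (y * s)) * w s)" for y
  define Q where "Q y s = (exp (- (y * s)) * w s - exp (- (z * s)) * w s) / (y - z)" for y s
  have "((\<lambda>y. integral {0<..} (Q y)) \<longlongrightarrow> integral {0<..} (\<lambda>s. - (exp (- (z * s)) * (s * w s))))
      (at z within {c<..})"
  proof (rule dominated_convergence_at[OF _ dom])
    fix y assume y: "y \<in> {c<..} - {z}"
    then show "Q y integrable_on {0<..}"
      unfolding Q_def using z by (intro integrable_on_divide integrable_diff int) auto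
    fix s :: real assume "s \<in> {0<..}"
    then have "\<bar>exp (- (y * s)) - exp (- (z * s))\<bar> * \<bar>w s\<bar> \<le> s * exp (- (c * s)) * \<bar>y - z\<bar> * \<bar>w s\<bar>"
      using y z by (intro mult_right_mono exp_minus_mult_lipschitz) auto
    moreover have "norm (Q y s) = \<bar>exp (- (y * s)) - exp (- (z * s))\<bar> * \<bar>w s\<bar> / \<bar>y - z\<bar>"
      by (simp add: Q_def abs_mult flip: left_diff_distrib)
    ultimately show "norm (Q y s) \<le> exp (- (c * s)) * (s * \<bar>w s\<bar>)"
      using y by (simp add: pos_divide_le_eq mult_ac)
  next
    fix s :: real
    have "((\<lambda>y. exp (- (y * s)) * w s) has_real_derivative - (exp (- (z * s)) * (s * w s)))
        (at z within {c<..})"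
      by (auto intro!: derivative_eq_intros)
    then show "((\<lambda>y. Q y s) \<longlongrightarrow> - (exp (- (z * s)) * (s * w s))) (at z within {c<..})"
      by (simp add: has_field_derivative_iff Q_def)
  qed
  moreover have "integral {0<..} (Q y) = (L y - L z) / (y - z)" if "y > c" for y
    unfolding Q_def L_def by (simp only: integral_divide integral_diff[OF int[OF that] int[OF z]])
  then have "eventually (\<lambda>y. integral {0<..} (Q y) = (L y - L z) / (y - z)) (at z within {c<..})"
    by (auto simp: eventually_at_filter)
  ultimately have "((\<lambda>y. (L y - L z) / (y - z)) \<longlongrightarrow>
      - integral {0<..} (\<lambda>s. exp (- (z * s)) * (s * w s)))
      (at z within {c<..})"
    by (simp add: Lim_transform_eventually)
  then show ?thesis
    using z by (simp add: has_field_derivative_iff L_def at_within_open[of z "{c<..}"])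
qed

section \<open>The Laplace integral of Tricomi's function\<close>

definition tricomi_weight :: "real \<Rightarrow> real \<Rightarrow> real \<Rightarrow> real" where
  "tricomi_weight p q s = s powr (p - 1) * (1 + s) powr (- q)"

definition tricomi_integral :: "real \<Rightarrow> real \<Rightarrow> real \<Rightarrow> real" where
  "tricomi_integral p q z = integral {0<..} (\<lambda>s. exp (- (z * s)) * tricomi_weight p q s)"

lemma tricomi_weight_nonneg [simp]: "tricomi_weight p q s \<ge> 0"
  by (simp add: tricomi_weight_def)

lemma tricomi_weight_le:
  assumes "q \<ge> 0" "s \<ge> 0"
  shows "tricomi_weight p q s \<le> s powr (p - 1)"
  using powr_mono[of "- q" 0 "1 + s"] assms by (auto simp: tricomi_weight_def intro!: mult_left_le)

lemma mult_tricomi_weight: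
  assumes "s > 0"
  shows "s * tricomi_weight p q s = tricomi_weight (p + 1) q s"
  using powr_add[of s "p - 1" 1] assms by (simp add: tricomi_weight_def)

lemma absolutely_integrable_tricomi:
  assumes "p > 0" "q \<ge> 0" "z > 0"
  shows "(\<lambda>s. exp (- (z * s)) * tricomi_weight p q s) absolutely_integrable_on {0<..}"
proof (rule measurable_bounded_by_integrable_imp_absolutely_integrable)
  show "(\<lambda>s. exp (- (z * s)) * tricomi_weight p q s) \<in> borel_measurable (lebesgue_on {0<..})"
    unfolding tricomi_weight_def
    by (intro continuous_imp_measurable_on_sets_lebesgue) (auto intro!: continuous_intros)
  show "(\<lambda>s. exp (- (z * s)) * s powr (p - 1)) integrable_on {0<..}"
    using has_integral_Gamma_scaled[OF assms(1,3)] by (rule has_integral_integrable)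
  show "norm (exp (- (z * s)) * tricomi_weight p q s) \<le> exp (- (z * s)) * s powr (p - 1)"
    if "s \<in> {0<..}" for s
    using tricomi_weight_le[OF assms(2), of s p] that by (simp add: abs_mult)
qed auto

lemma integrable_tricomi:
  assumes "p > 0" "q \<ge> 0" "z > 0"
  shows "(\<lambda>s. exp (- (z * s)) * tricomi_weight p q s) integrable_on {0<..}"
  using absolutely_integrable_tricomi[OF assms] by (rule set_lebesgue_integral_eq_integral(1))

lemma has_integral_tricomi:
  assumes "p > 0" "q \<ge> 0" "z > 0"
  shows "((\<lambda>s. exp (- (z * s)) * tricomi_weight p q s) has_integral tricomi_integral p q z) {0<..}"
  using integrable_tricomi[OF assms] unfolding tricomi_integral_def by (rule integrable_integral)

lemma tricomi_integral_nonneg: "tricomi_integral p q z \<ge> 0"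
  unfolding tricomi_integral_def
  by (cases "(\<lambda>s. exp (- (z * s)) * tricomi_weight p q s) integrable_on {0<..}")
     (auto intro!: integral_nonneg simp: not_integrable_integral)

lemma tricomi_integral_le:
  assumes "p > 0" "q \<ge> 0" "z > 0"
  shows "tricomi_integral p q z \<le> Gamma p * z powr (- p)"
  by (rule has_integral_le[OF has_integral_tricomi[OF assms] has_integral_Gamma_scaled[OF assms(1,3)]])
     (use tricomi_weight_le assms(2) in auto)

lemma has_real_derivative_tricomi_integral:
  assumes "p > 0" "q \<ge> 0" "z > 0"
  shows "(tricomi_integral p q has_real_derivative - tricomi_integral (p + 1) q z) (at z)"
proof -
  have "((\<lambda>z. integral {0<..} (\<lambda>s. exp (- (z * s)) * tricomi_weight p q s)) has_real_derivative
      - integral {0<..} (\<lambda>s. exp (- (z * s)) * (s * tricomi_weight p q s))) (at z)"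
  proof (rule has_real_derivative_laplace_integral[where c = "z / 2"])
    show "(\<lambda>s. exp (- (z / 2 * s)) * (s * \<bar>tricomi_weight p q s\<bar>)) integrable_on {0<..}"
      using integrable_tricomi[of "p + 1" q "z / 2"] assms
      by (subst integrable_cong) (auto simp: mult_tricomi_weight)
  qed (use assms in \<open>auto intro!: integrable_tricomi\<close>)
  moreover have "integral {0<..} (\<lambda>s. exp (- (z * s)) * (s * tricomi_weight p q s)) =
      tricomi_integral (p + 1) q z"
    unfolding tricomi_integral_def by (rule integral_cong) (simp add: mult_tricomi_weight)
  ultimately show ?thesis by (simp only: tricomi_integral_def[abs_def])
qed

lemma has_real_derivative_exp_powr_powr:
  assumes s: "s > 0"
  shows "((\<lambda>s. exp (- (z * s)) * s powr p * (1 + s) powr (1 - q)) has_real_derivative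
    p * (exp (- (z * s)) * tricomi_weight p q s)
    + (p + 1 - q) * (exp (- (z * s)) * tricomi_weight (p + 1) q s)
    - z * (exp (- (z * s)) * tricomi_weight (p + 2) q s
      + exp (- (z * s)) * tricomi_weight (p + 1) q s)) (at s)"
proof -
  have powr: "s powr p = s * s powr (p - 1)" "(1 + s) powr (1 - q) = (1 + s) * (1 + s) powr (- q)"
    using powr_add[of s "p - 1" 1] powr_add[of "1 + s" "- q" 1] s by simp_all
  have weights: "tricomi_weight (p + 1) q s = s * tricomi_weight p q s"
      "tricomi_weight (p + 2) q s = s * (s * tricomi_weight p q s)"
    using mult_tricomi_weight[OF s, of p q] mult_tricomi_weight[OF s, of "p + 1" q]
    by (simp_all add: add.assoc)
  have "((\<lambda>s. exp (- (z * s))) has_real_derivative - z * exp (- (z * s))) (at s)"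
    by (auto intro!: derivative_eq_intros)
  moreover have "((\<lambda>s. s powr p) has_real_derivative p * s powr (p - 1)) (at s)"
    by (rule has_real_derivative_powr[OF s])
  moreover have "((\<lambda>s. (1 + s) powr (1 - q)) has_real_derivative
      (1 - q) * (1 + s) powr (- q)) (at s)"
    using DERIV_fun_powr[of "\<lambda>s. 1 + s" 1 s "1 - q"] s by (auto intro!: derivative_eq_intros)
  ultimately have "((\<lambda>s. exp (- (z * s)) * s powr p * (1 + s) powr (1 - q)) has_real_derivative
      (- z * exp (- (z * s)) * s powr p + p * s powr (p - 1) * exp (- (z * s)))
        * (1 + s) powr (1 - q)
      + (1 - q) * (1 + s) powr (- q) * (exp (- (z * s)) * s powr p)) (at s)"
    by (intro DERIV_mult)
  then show ?thesis
    by (rule DERIV_cong) (unfold powr weights, simp add: tricomi_weight_def algebra_simps)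
qed

lemma tricomi_integral_by_parts:
  assumes "p > 0" "q \<ge> 0" "z > 0"
  shows "z * (tricomi_integral (p + 2) q z + tricomi_integral (p + 1) q z) =
    p * tricomi_integral p q z + (p + 1 - q) * tricomi_integral (p + 1) q z"
proof -
  let ?e = "\<lambda>r s. exp (- (z * s)) * tricomi_weight r q s"
  let ?f = "\<lambda>s. p * ?e p s + (p + 1 - q) * ?e (p + 1) s - z * (?e (p + 2) s + ?e (p + 1) s)"
  have "(?f has_integral (p * tricomi_integral p q z + (p + 1 - q) * tricomi_integral (p + 1) q z
      - z * (tricomi_integral (p + 2) q z + tricomi_integral (p + 1) q z))) {0<..}"
    by (intro has_integral_diff has_integral_add has_integral_mult_right has_integral_tricomi)
       (use assms in auto)
  moreover have "integral {0<..} ?f = 0 - 0"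
  proof (rule integral_derivative_halfline[OF has_real_derivative_exp_powr_powr])
    have "?e r absolutely_integrable_on {0<..}" if "r \<ge> p" for r
      by (rule absolutely_integrable_tricomi) (use assms that in auto)
    then show "?f absolutely_integrable_on {0<..}"
      by (intro set_integral_diff set_integral_add set_integrable_mult_right) auto
    show "((\<lambda>s. exp (- (z * s)) * s powr p * (1 + s) powr (1 - q)) \<longlongrightarrow> 0) (at_right 0)"
      "((\<lambda>s. exp (- (z * s)) * s powr p * (1 + s) powr (1 - q)) \<longlongrightarrow> 0) at_top"
      using assms by real_asymp+
  qed
  ultimately show ?thesis by (simp add: has_integral_iff)
qed

lemma tricomi_integral_tendsto_Beta:
  assumes "p > 0" "q > p"
  shows "(tricomi_integral p q \<longlongrightarrow> Beta p (q - p)) (at_right 0)"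
proof -
  have Beta: "(tricomi_weight p q has_integral Beta p (q - p)) {0<..}"
    using has_integral_Beta_halfline[of p "q - p"] assms by (simp add: tricomi_weight_def[abs_def])
  have "(tricomi_integral p q \<longlongrightarrow> integral {0<..} (tricomi_weight p q)) (at_right 0)"
    unfolding tricomi_integral_def[abs_def]
  proof (rule dominated_convergence_at)
    show "tricomi_weight p q integrable_on {0<..}"
      using Beta by (rule has_integral_integrable)
    show "norm (exp (- (z * s)) * tricomi_weight p q s) \<le> tricomi_weight p q s"
      if "z \<in> {0<..} - {0}" "s \<in> {0<..}" for z s
      using that by (simp add: abs_mult mult_left_le_one_le)
    fix s :: real
    have "((\<lambda>z. exp (- (z * s)) * tricomi_weight p q s) \<longlongrightarrow>
        exp (- (0 * s)) * tricomi_weight p q s) (at_right 0)"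
      by (intro tendsto_intros)
    then show "((\<lambda>z. exp (- (z * s)) * tricomi_weight p q s) \<longlongrightarrow> tricomi_weight p q s) (at_right 0)"
      by simp
  qed (use assms in \<open>auto intro!: integrable_tricomi\<close>)
  then show ?thesis using Beta by (simp add: integral_unique)
qed

lemma has_integral_tricomi_scaled:
  assumes "p > 0" "q \<ge> 0" "z > 0"
  shows "((\<lambda>s. exp (- s) * s powr (p - 1) * (z + s) powr (- q)) has_integral
    z powr (p - q) * tricomi_integral p q z) {0<..}"
proof -
  have "((\<lambda>s. exp (- (z * (1 / z * s))) * tricomi_weight p q (1 / z * s)) has_integral
      tricomi_integral p q z / (1 / z)) {0<..}"
    using has_integral_tricomi[OF assms] assms(3)
    by (intro has_integral_scale_halfline) auto
  from has_integral_mult_right[OF this, of "z powr (p - 1 - q)"]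
  have "((\<lambda>s. z powr (p - 1 - q) * (exp (- (z * (1 / z * s))) * tricomi_weight p q (1 / z * s)))
      has_integral z powr (p - 1 - q) * (tricomi_integral p q z / (1 / z))) {0<..}" .
  also have "z powr (p - 1 - q) * (tricomi_integral p q z / (1 / z)) =
      z powr (p - q) * tricomi_integral p q z"
    using powr_add[of z "p - 1 - q" 1] assms(3) by simp
  finally show ?thesis
  proof (rule has_integral_eq[rotated])
    fix s :: real assume s: "s \<in> {0<..}"
    have "1 + s / z = (z + s) / z" using assms(3) by (simp add: field_simps)
    moreover have "z powr (p - 1 - q) = z powr (p - 1) / z powr q" by (rule powr_diff)
    ultimately show "z powr (p - 1 - q) * (exp (- (z * (1 / z * s))) * tricomi_weight p q (1 / z * s)) =
        exp (- s) * s powr (p - 1) * (z + s) powr (- q)"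
      using s assms(3) by (simp add: tricomi_weight_def powr_divide powr_minus field_simps)
  qed
qed

lemma tricomi_integral_asymp_at_0:
  assumes "q \<ge> 0" "p > q"
  shows "((\<lambda>z. z powr (p - q) * tricomi_integral p q z) \<longlongrightarrow> Gamma (p - q)) (at_right 0)"
proof -
  have Gamma: "((\<lambda>s. exp (- s) * s powr (p - 1) * s powr (- q)) has_integral Gamma (p - q)) {0<..}"
    using has_integral_Gamma_scaled[of "p - q" 1] assms
    by (simp add: mult.assoc diff_diff_eq add.commute flip: powr_add)
  have "((\<lambda>z. integral {0<..} (\<lambda>s. exp (- s) * s powr (p - 1) * (z + s) powr (- q))) \<longlongrightarrow>
      integral {0<..} (\<lambda>s. exp (- s) * s powr (p - 1) * s powr (- q))) (at_right 0)"
  proof (rule dominated_convergence_at[OF _ has_integral_integrable[OF Gamma]])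
    show "(\<lambda>s. exp (- s) * s powr (p - 1) * (z + s) powr (- q)) integrable_on {0<..}"
      if "z \<in> {0<..} - {0}" for z
      using has_integral_integrable[OF has_integral_tricomi_scaled[of p q z]] that assms by simp
    show "norm (exp (- s) * s powr (p - 1) * (z + s) powr (- q))
        \<le> exp (- s) * s powr (p - 1) * s powr (- q)"
      if "z \<in> {0<..} - {0}" "s \<in> {0<..}" for z s
      using that assms by (auto simp: abs_mult intro!: mult_left_mono powr_mono2')
    fix s :: real assume "s \<in> {0<..}"
    then have "((\<lambda>z. exp (- s) * s powr (p - 1) * (z + s) powr (- q)) \<longlongrightarrow>
        exp (- s) * s powr (p - 1) * (0 + s) powr (- q)) (at_right 0)"
      by (intro tendsto_intros) auto
    then show "((\<lambda>z. exp (- s) * s powr (p - 1) * (z + s) powr (- q)) \<longlongrightarrow>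
        exp (- s) * s powr (p - 1) * s powr (- q)) (at_right 0)" by simp
  qed
  moreover have "eventually (\<lambda>z. integral {0<..} (\<lambda>s. exp (- s) * s powr (p - 1) * (z + s) powr (- q))
      = z powr (p - q) * tricomi_integral p q z) (at_right 0)"
    using eventually_at_right_less[of 0]
    by eventually_elim (use assms in \<open>auto intro!: integral_unique has_integral_tricomi_scaled\<close>)
  ultimately show ?thesis
    unfolding integral_unique[OF Gamma] by (rule Lim_transform_eventually)
qed

section \<open>Identification of Tricomi's function with its Laplace integral\<close>

lemma gronwall_zero_at_right:
  fixes E E' :: "real \<Rightarrow> real"
  assumes deriv: "\<And>y. a < y \<Longrightarrow> y \<le> x \<Longrightarrow> (E has_real_derivative E' y) (at y)"
    and le: "\<And>y. a < y \<Longrightarrow> y \<le> x \<Longrightarrow> E' y \<le> K * E y"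
    and lim: "(E \<longlongrightarrow> 0) (at_right a)" and x: "a < x"
  shows "E x \<le> 0"
proof -
  define F where "F y = E y * exp (- K * y)" for y
  have F_mono: "F x \<le> F y" if y: "a < y" "y \<le> x" for y
  proof (rule DERIV_nonpos_imp_nonincreasing[OF y(2)])
    fix r assume "y \<le> r" "r \<le> x"
    then have r: "a < r" "r \<le> x" using y by auto
    have "(F has_real_derivative (E' r - K * E r) * exp (- K * r)) (at r)"
      unfolding F_def[abs_def]
      by (rule derivative_eq_intros deriv[OF r] refl | simp add: algebra_simps)+
    moreover have "(E' r - K * E r) * exp (- K * r) \<le> 0"
      using le[OF r] by (intro mult_nonpos_nonneg) auto
    ultimately show "\<exists>D. (F has_real_derivative D) (at r) \<and> D \<le> 0" by blast
  qed
  have "(F \<longlongrightarrow> 0 * exp (- K * a)) (at_right a)"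
    unfolding F_def by (intro tendsto_intros lim)
  then have "(F \<longlongrightarrow> 0) (at_right a)" by simp
  moreover have "eventually (\<lambda>y. F x \<le> F y) (at_right a)"
    using eventually_at_right_less[of a] eventually_at_right_real[OF x]
    by eventually_elim (auto intro!: F_mono)
  ultimately have "F x \<le> 0" by (rule tendsto_lowerbound) simp
  then show ?thesis by (simp add: F_def mult_le_0_iff)
qed

lemma linear_ode2_energy_bound:
  fixes u v p q B :: real
  assumes "\<bar>p\<bar> \<le> B" "\<bar>q\<bar> \<le> B"
  shows "2 * u * v + 2 * v * (p * v + q * u) \<le> (1 + 3 * B) * (u\<^sup>2 + v\<^sup>2)"
proof -
  have "(1 + q) * (2 * u * v) \<le> \<bar>(1 + q) * (2 * u * v)\<bar>"
    by (rule abs_ge_self)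
  also have "\<dots> = \<bar>1 + q\<bar> * (2 * \<bar>u\<bar> * \<bar>v\<bar>)"
    unfolding abs_mult by simp
  also have "\<dots> \<le> (1 + B) * (u\<^sup>2 + v\<^sup>2)"
    using assms sum_squares_bound[of "\<bar>u\<bar>" "\<bar>v\<bar>"] by (intro mult_mono) auto
  finally have "(1 + q) * (2 * u * v) \<le> (1 + B) * (u\<^sup>2 + v\<^sup>2)" .
  moreover have "p * v\<^sup>2 \<le> B * v\<^sup>2" "0 \<le> B * u\<^sup>2"
    using assms by (auto intro!: mult_right_mono mult_nonneg_nonneg)
  ultimately show ?thesis by (simp add: algebra_simps power2_eq_square)
qed

lemma linear_ode2_zero_at_right:
  fixes u u' p q :: "real \<Rightarrow> real"
  assumes u: "\<And>y. y > a \<Longrightarrow> (u has_real_derivative u' y) (at y)"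
    and u': "\<And>y. y > a \<Longrightarrow> (u' has_real_derivative p y * u' y + q y * u y) (at y)"
    and bound: "\<And>y. a < y \<Longrightarrow> y \<le> x \<Longrightarrow> \<bar>p y\<bar> \<le> B \<and> \<bar>q y\<bar> \<le> B"
    and lim: "(u \<longlongrightarrow> 0) (at_right a)" "(u' \<longlongrightarrow> 0) (at_right a)" and x: "a < x"
  shows "u x = 0"
proof -
  have "(u x)\<^sup>2 + (u' x)\<^sup>2 \<le> 0"
  proof (rule gronwall_zero_at_right[OF _ _ _ x])
    fix y assume y: "a < y" "y \<le> x"
    show "((\<lambda>y. (u y)\<^sup>2 + (u' y)\<^sup>2) has_real_derivative
        2 * u y * u' y + 2 * u' y * (p y * u' y + q y * u y)) (at y)"
      by (rule derivative_eq_intros u u' y refl | simp add: algebra_simps)+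
    show "2 * u y * u' y + 2 * u' y * (p y * u' y + q y * u y)
        \<le> (1 + 3 * B) * ((u y)\<^sup>2 + (u' y)\<^sup>2)"
      using bound[OF y] by (intro linear_ode2_energy_bound) auto
  next
    have "((\<lambda>y. (u y)\<^sup>2 + (u' y)\<^sup>2) \<longlongrightarrow> 0\<^sup>2 + 0\<^sup>2) (at_right a)"
      by (intro tendsto_intros lim)
    then show "((\<lambda>y. (u y)\<^sup>2 + (u' y)\<^sup>2) \<longlongrightarrow> 0) (at_right a)" by simp
  qed
  then show ?thesis by (simp add: sum_power2_le_zero_iff)
qed

definition tricomi_cube :: "real \<Rightarrow> real \<Rightarrow> real \<Rightarrow> real" where
  "tricomi_cube p q y = tricomi_integral p q (y ^ 3 / 9)"

lemma has_real_derivative_tricomi_cube: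
  assumes "p > 0" "q \<ge> 0" "y > 0"
  shows "(tricomi_cube p q has_real_derivative - (y\<^sup>2 / 3) * tricomi_cube (p + 1) q y) (at y)"
proof -
  have "((\<lambda>y. y ^ 3 / 9) has_real_derivative y\<^sup>2 / 3) (at y)"
    by (auto intro!: derivative_eq_intros)
  moreover have "(tricomi_integral p q has_real_derivative - tricomi_integral (p + 1) q (y ^ 3 / 9))
      (at (y ^ 3 / 9))"
    by (rule has_real_derivative_tricomi_integral) (use assms in auto)
  ultimately have "((\<lambda>y. tricomi_integral p q (y ^ 3 / 9)) has_real_derivative
      - tricomi_integral (p + 1) q (y ^ 3 / 9) * (y\<^sup>2 / 3)) (at y)"
    by (intro DERIV_chain2)
  then show ?thesis by (simp add: tricomi_cube_def[abs_def] mult_ac)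
qed

lemma tricomi_cube_ode:
  assumes a: "a > 0" and y: "y > 0"
  shows "((\<lambda>y. - (y\<^sup>2 / 3) * tricomi_cube (a + 1) (a + 1/3) y) has_real_derivative
    y\<^sup>2 / 3 * (- (y\<^sup>2 / 3) * tricomi_cube (a + 1) (a + 1/3) y)
      + a * y * tricomi_cube a (a + 1/3) y) (at y)"
proof -
  define z where "z = y ^ 3 / 9"
  define T where "T j = tricomi_cube (a + j) (a + 1/3) y" for j
  have "z * (T 2 + T 1) = a * T 0 + 2/3 * T 1"
    using tricomi_integral_by_parts[of a "a + 1/3" z] a y by (simp add: T_def tricomi_cube_def z_def)
  then have parts: "z * T 2 = a * T 0 + 2/3 * T 1 - z * T 1"
    by (simp add: algebra_simps)
  have "((\<lambda>y. - (y\<^sup>2 / 3)) has_real_derivative - (2 * y / 3)) (at y)"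
    by (auto intro!: derivative_eq_intros)
  from DERIV_mult[OF this has_real_derivative_tricomi_cube[of "a + 1" "a + 1/3" y]]
  have "((\<lambda>y. - (y\<^sup>2 / 3) * tricomi_cube (a + 1) (a + 1/3) y) has_real_derivative
      - (2 * y / 3) * T 1 + (- (y\<^sup>2 / 3) * T 2) * (- (y\<^sup>2 / 3))) (at y)"
    using a y by (simp add: T_def add.assoc)
  also have "- (2 * y / 3) * T 1 + (- (y\<^sup>2 / 3) * T 2) * (- (y\<^sup>2 / 3)) = y * (z * T 2 - 2/3 * T 1)"
    by (simp add: z_def algebra_simps power2_eq_square power3_eq_cube)
  also have "\<dots> = y\<^sup>2 / 3 * (- (y\<^sup>2 / 3) * T 1) + a * y * T 0"
    unfolding parts by (simp add: z_def algebra_simps power2_eq_square power3_eq_cube)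
  finally show ?thesis by (simp add: T_def)
qed

lemma filterlim_cube_at_right_0: "filterlim (\<lambda>y::real. y ^ 3 / 9) (at_right 0) (at_right 0)"
  by real_asymp

lemma tricomi_cube_tendsto_Beta:
  assumes "a > 0"
  shows "(tricomi_cube a (a + 1/3) \<longlongrightarrow> Beta a (1/3)) (at_right 0)"
  using filterlim_compose[OF tricomi_integral_tendsto_Beta[of a "a + 1/3"]
      filterlim_cube_at_right_0] assms
  by (simp add: tricomi_cube_def[abs_def])

lemma Gamma_two_thirds: "Gamma (2/3) = - (1/3) * Gamma (-1/3 :: real)"
proof -
  have "(-1/3::real) \<notin> \<int>\<^sub>\<le>\<^sub>0"
  proof
    assume "(-1/3::real) \<in> \<int>\<^sub>\<le>\<^sub>0"
    then obtain n :: int where "-1/3 = real_of_int n" by (auto elim!: nonpos_Ints_cases)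
    then have "3 * n = -1" by linarith
    then show False by presburger
  qed
  from Gamma_plus1[OF this] show ?thesis by simp
qed

lemma deriv_tricomi_cube_tendsto:
  assumes "a > 0"
  shows "((\<lambda>y. - (y\<^sup>2 / 3) * tricomi_cube (a + 1) (a + 1/3) y) \<longlongrightarrow>
    Gamma (-1/3) / 9 powr (1/3)) (at_right 0)"
proof -
  let ?c = "9 powr (2/3) / 3 :: real"
  have "((\<lambda>z. z powr (2/3) * tricomi_integral (a + 1) (a + 1/3) z) \<longlongrightarrow> Gamma (2/3)) (at_right 0)"
    using tricomi_integral_asymp_at_0[of "a + 1/3" "a + 1"] assms by simp
  from filterlim_compose[OF this filterlim_cube_at_right_0]
  have "((\<lambda>y. - ?c * ((y ^ 3 / 9) powr (2/3) * tricomi_cube (a + 1) (a + 1/3) y)) \<longlongrightarrow>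
      - ?c * Gamma (2/3)) (at_right 0)"
    unfolding tricomi_cube_def by (rule tendsto_mult_left)
  moreover have "- ?c * Gamma (2/3) = Gamma (-1/3) / 9 powr (1/3)"
  proof -
    have "9 powr (2/3) * 9 powr (1/3) = (9::real)" by (simp flip: powr_add)
    then show ?thesis by (simp add: Gamma_two_thirds field_simps)
  qed
  moreover have "eventually (\<lambda>y. - ?c * ((y ^ 3 / 9) powr (2/3) * tricomi_cube (a + 1) (a + 1/3) y)
      = - (y\<^sup>2 / 3) * tricomi_cube (a + 1) (a + 1/3) y) (at_right 0)"
    using eventually_at_right_less[of 0]
  proof eventually_elim
    case (elim y)
    have "(y ^ 3) powr (2/3) = (y powr 3) powr (2/3)" using elim by simp
    also have "\<dots> = y\<^sup>2" using elim by (simp only: powr_powr) simp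
    finally show ?case by (simp add: powr_divide)
  qed
  ultimately show ?thesis by (simp only:) (rule Lim_transform_eventually)
qed

lemma kummerM_0 [simp]: "kummerM a b 0 = 1"
  using sums_unique2[OF kummerM_sums powser_sums_zero] by (simp add: kummer_coeff_def)

lemma Gamma_mult_kummerU_0: "Gamma a * kummerU a 0 = Beta a (1/3)"
  by (simp add: kummerU_def kummerP_def kummerQ_def kummerU_init_def Beta_altdef)

lemma Gamma_mult_deriv_kummerU_0:
  assumes "a \<notin> \<int>\<^sub>\<le>\<^sub>0"
  shows "Gamma a * deriv (kummerU a) 0 = - (Gamma (-1/3) / 9 powr (1/3))"
  using Gamma_nonzero[OF assms]
  by (simp add: deriv_kummerU deriv_kummerP deriv_kummerQ kummerU_slope_def
      rGamma_inverse_Gamma field_simps)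

lemma has_real_derivative_kummerU_reflect:
  "((\<lambda>y. kummerU a (- y)) has_real_derivative - deriv (kummerU a) (- y)) (at y)"
  using has_real_derivative_kummerU by (rule DERIV_mirror[THEN iffD1])

lemma kummerU_reflect_ode:
  "((\<lambda>y. - deriv (kummerU a) (- y)) has_real_derivative
    y\<^sup>2 / 3 * (- deriv (kummerU a) (- y)) + a * y * kummerU a (- y)) (at y)"
proof -
  have "((\<lambda>y. - deriv (kummerU a) (- y)) has_real_derivative
      a * (a + 1/3) * y * kummerU (a + 1) (- y)) (at y)"
    using DERIV_minus[OF DERIV_mirror[THEN iffD1, OF has_real_derivative_deriv_kummerU[of a "- y"]]]
    by simp
  also have "a * (a + 1/3) * y * kummerU (a + 1) (- y) =
      y / 3 * (3 * (a * (a + 1/3)) * kummerU (a + 1) (- y))"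
    by simp
  also have "3 * (a * (a + 1/3)) * kummerU (a + 1) (- y) =
      - y * deriv (kummerU a) (- y) + 3 * a * kummerU a (- y)"
    using kummerU_raise[of "- y" a] by simp
  finally show ?thesis by (simp add: algebra_simps power2_eq_square)
qed

theorem kummerU_eq_tricomi_cube:
  assumes a: "a > 0" and x: "x > 0"
  shows "Gamma a * kummerU a (- x) = tricomi_cube a (a + 1/3) x"
proof -
  define u where "u y = tricomi_cube a (a + 1/3) y - Gamma a * kummerU a (- y)" for y
  define u' where "u' y = - (y\<^sup>2 / 3) * tricomi_cube (a + 1) (a + 1/3) y
    - Gamma a * (- deriv (kummerU a) (- y))" for y
  have "u x = 0"
  proof (rule linear_ode2_zero_at_right[OF _ _ _ _ _ x])
    fix y :: real assume y: "y > 0"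
    show "(u has_real_derivative u' y) (at y)"
      unfolding u_def[abs_def] u'_def
      by (intro DERIV_diff DERIV_cmult has_real_derivative_tricomi_cube
          has_real_derivative_kummerU_reflect)
         (use a y in auto)
    show "(u' has_real_derivative y\<^sup>2 / 3 * u' y + a * y * u y) (at y)"
      unfolding u'_def[abs_def] u_def
      by (rule DERIV_cong[OF DERIV_diff[OF tricomi_cube_ode[OF a y] DERIV_cmult[OF kummerU_reflect_ode]]])
         (simp add: algebra_simps)
    assume "y \<le> x"
    then have "y\<^sup>2 \<le> x\<^sup>2" "\<bar>a * y\<bar> \<le> a * x"
      using y a by (auto simp: abs_mult intro!: power_mono)
    then show "\<bar>y\<^sup>2 / 3\<bar> \<le> max (x\<^sup>2) (a * x) \<and> \<bar>a * y\<bar> \<le> max (x\<^sup>2) (a * x)" by auto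
  next
    have lim_at_right: "(f \<longlongrightarrow> f 0) (at_right 0)" if "(f has_real_derivative D) (at 0)" for f D
      using DERIV_isCont[OF that] by (simp add: isCont_def filterlim_at_split)
    have "(u \<longlongrightarrow> Beta a (1/3) - Gamma a * kummerU a (- 0)) (at_right 0)"
      unfolding u_def[abs_def]
      by (intro tendsto_diff tendsto_mult_left tricomi_cube_tendsto_Beta a
          lim_at_right[OF has_real_derivative_kummerU_reflect])
    moreover have "(u' \<longlongrightarrow> Gamma (-1/3) / 9 powr (1/3)
        - Gamma a * (- deriv (kummerU a) (- 0))) (at_right 0)"
      unfolding u'_def[abs_def]
      by (intro tendsto_diff tendsto_mult_left deriv_tricomi_cube_tendsto a
          lim_at_right[OF kummerU_reflect_ode])
    ultimately show "(u \<longlongrightarrow> 0) (at_right 0)" "(u' \<longlongrightarrow> 0) (at_right 0)"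
      using a by (simp_all add: Gamma_mult_kummerU_0 Gamma_mult_deriv_kummerU_0 pos_not_nonpos_Ints)
  qed
  then show ?thesis by (simp add: u_def)
qed

section \<open>Decay of Tricomi's function at both ends\<close>

lemma kummerU_bigo_at_bot:
  assumes "a > 0"
  shows "kummerU a \<in> O[at_bot](\<lambda>t. \<bar>t\<bar> powr (- 3 * a))"
proof (rule bigoI[where c = "9 powr a"], rule eventually_mono[OF eventually_gt_at_bot[of 0]])
  fix t :: real assume t: "t < 0"
  define x where "x = - t"
  have x: "x > 0" using t by (simp add: x_def)
  have Gamma: "Gamma a > 0" using assms by (rule Gamma_real_pos)
  have "Gamma a * \<bar>kummerU a (- x)\<bar> = \<bar>tricomi_cube a (a + 1/3) x\<bar>"
    using Gamma kummerU_eq_tricomi_cube[OF assms x]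
    by (simp add: abs_mult flip: kummerU_eq_tricomi_cube[OF assms x])
  also have "\<dots> \<le> Gamma a * (x ^ 3 / 9) powr (- a)"
    using tricomi_integral_nonneg tricomi_integral_le[of a "a + 1/3" "x ^ 3 / 9"] assms x
    by (simp add: tricomi_cube_def)
  finally have "\<bar>kummerU a (- x)\<bar> \<le> (x ^ 3 / 9) powr (- a)" using Gamma by simp
  also have "\<dots> = (x powr 3) powr (- a) / 9 powr (- a)" using x by (simp add: powr_divide)
  also have "\<dots> = 9 powr a * x powr (- 3 * a)"
    by (simp only: powr_powr) (simp add: powr_minus divide_inverse)
  finally show "norm (kummerU a t) \<le> 9 powr a * norm (\<bar>t\<bar> powr (- 3 * a))"
    using t by (simp add: x_def)
qed

definition kummerU_energy :: "real \<Rightarrow> real \<Rightarrow> real" where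
  "kummerU_energy a x =
    x powr (6 * a) * (a * (a + 1/3) * (kummerU (a + 1) x)\<^sup>2 + (kummerU a x)\<^sup>2)"

lemma has_real_derivative_kummerU_energy:
  assumes "x > 0"
  shows "(kummerU_energy a has_real_derivative
    x powr (6 * a) * (2 * (a * (a + 1/3)) * (6 * a + 1 - x ^ 3 / 3) * (kummerU (a + 1) x)\<^sup>2)
      / x) (at x)"
proof -
  define \<kappa> where "\<kappa> = a * (a + 1/3)"
  define u u' where "u = kummerU a x" and "u' = deriv (kummerU a) x"
  define w w' where "w = kummerU (a + 1) x" and "w' = deriv (kummerU (a + 1)) x"
  have raise: "x * u' = 3 * \<kappa> * w - 3 * a * u"
    unfolding u_def u'_def w_def \<kappa>_def by (rule kummerU_raise)
  have lower: "x * w' = (3 * a + 1 - x ^ 3 / 3) * w - 3 * u"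
    unfolding u_def w_def w'_def by (rule kummerU_lower)
  have "((\<lambda>x. x powr (6 * a)) has_real_derivative x powr (6 * a) * (6 * a) / x) (at x)"
    using has_real_derivative_powr[OF assms, of "6 * a"] assms by (simp add: powr_diff mult_ac)
  moreover have "((\<lambda>x. \<kappa> * (kummerU (a + 1) x)\<^sup>2 + (kummerU a x)\<^sup>2) has_real_derivative
      \<kappa> * (2 * w * w') + 2 * u * u') (at x)"
    unfolding u_def u'_def w_def w'_def
    by (rule derivative_eq_intros has_real_derivative_kummerU refl | simp)+
  ultimately have "(kummerU_energy a has_real_derivative
      x powr (6 * a) * (6 * a) / x * (\<kappa> * w\<^sup>2 + u\<^sup>2)
      + (\<kappa> * (2 * w * w') + 2 * u * u') * x powr (6 * a)) (at x)"
    unfolding kummerU_energy_def[abs_def] \<kappa>_def u_def w_def by (rule DERIV_mult)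
  also have "x powr (6 * a) * (6 * a) / x * (\<kappa> * w\<^sup>2 + u\<^sup>2)
      + (\<kappa> * (2 * w * w') + 2 * u * u') * x powr (6 * a)
      = x powr (6 * a) * (6 * a * (\<kappa> * w\<^sup>2 + u\<^sup>2) + 2 * \<kappa> * w * (x * w') + 2 * u * (x * u')) / x"
    using assms by (simp add: field_simps)
  \<comment> \<open>The cross terms \<open>u w\<close> cancel, and so do the multiples of \<open>u\<^sup>2\<close>.\<close>
  also have "6 * a * (\<kappa> * w\<^sup>2 + u\<^sup>2) + 2 * \<kappa> * w * (x * w') + 2 * u * (x * u')
      = 2 * \<kappa> * (6 * a + 1 - x ^ 3 / 3) * w\<^sup>2"
    unfolding raise lower by (simp add: algebra_simps power2_eq_square)
  finally show ?thesis by (simp only: \<kappa>_def w_def)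
qed

lemma kummerU_energy_antimono:
  assumes "a > 0" "1 \<le> x" "3 * (6 * a + 1) \<le> x" "x \<le> y"
  shows "kummerU_energy a y \<le> kummerU_energy a x"
proof (rule DERIV_nonpos_imp_nonincreasing[OF assms(4)])
  fix r assume r: "x \<le> r" "r \<le> y"
  have "r \<le> r ^ 3" using power_increasing[of 1 3 r] r assms by simp
  then have "6 * a + 1 - r ^ 3 / 3 \<le> 0" using r assms by simp
  then have "r powr (6 * a) * (2 * (a * (a + 1/3)) * (6 * a + 1 - r ^ 3 / 3) *
      (kummerU (a + 1) r)\<^sup>2) / r \<le> 0"
    using assms r by (intro divide_nonpos_pos mult_nonneg_nonpos mult_nonpos_nonneg) auto
  then show "\<exists>D. (kummerU_energy a has_real_derivative D) (at r) \<and> D \<le> 0"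
    using has_real_derivative_kummerU_energy[of r a] r assms by (intro exI conjI) auto
qed

lemma kummerU_bigo_at_top:
  assumes "a > 0"
  shows "kummerU a \<in> O[at_top](\<lambda>t. \<bar>t\<bar> powr (- 3 * a))"
proof -
  define T where "T = max 1 (3 * (6 * a + 1))"
  show ?thesis
  proof (rule bigoI[where c = "sqrt (kummerU_energy a T)"],
      rule eventually_mono[OF eventually_ge_at_top[of T]])
    fix t assume t: "t \<ge> T"
    then have "t > 0" by (simp add: T_def)
    have "(\<bar>kummerU a t\<bar> * t powr (3 * a))\<^sup>2 = t powr (6 * a) * (kummerU a t)\<^sup>2"
      using powr_add[of t "3 * a" "3 * a"] by (simp add: power_mult_distrib power2_eq_square)
    also have "\<dots> \<le> kummerU_energy a t"
      using assms by (simp add: kummerU_energy_def mult_left_mono)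
    also have "\<dots> \<le> kummerU_energy a T"
      using assms t by (intro kummerU_energy_antimono) (auto simp: T_def)
    finally have "\<bar>kummerU a t\<bar> * t powr (3 * a) \<le> sqrt (kummerU_energy a T)"
      by (rule real_le_rsqrt)
    then show "norm (kummerU a t) \<le> sqrt (kummerU_energy a T) * norm (\<bar>t\<bar> powr (- 3 * a))"
      using \<open>t > 0\<close> by (simp add: powr_minus field_simps)
  qed
qed

lemma kummerU_bigo:
  assumes "a > 0"
  shows "kummerU a \<in> O[at_infinity](\<lambda>t. \<bar>t\<bar> powr (- 3 * a))"
  unfolding at_infinity_eq_at_top_bot
  by (intro landau_o.big.sup kummerU_bigo_at_top kummerU_bigo_at_bot assms)

lemma powr_bigo_powr_at_infinity:
  assumes "p \<le> q"
  shows "(\<lambda>t. \<bar>t\<bar> powr p) \<in> O[at_infinity](\<lambda>t::real. \<bar>t\<bar> powr q)"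
proof (rule bigoI[where c = 1])
  have "\<bar>t\<bar> powr p \<le> \<bar>t\<bar> powr q" if "\<bar>t\<bar> \<ge> 1" for t :: real
    using that assms by (rule powr_mono[rotated])
  then show "eventually (\<lambda>t. norm (\<bar>t\<bar> powr p) \<le> 1 * norm (\<bar>t::real\<bar> powr q)) at_infinity"
    by (auto simp: eventually_at_infinity intro!: exI[of _ 1])
qed

lemma deriv_kummerU_bigo:
  assumes "a > 0"
  shows "deriv (kummerU a) \<in> O[at_infinity](\<lambda>t. \<bar>t\<bar> powr (- 3 * a - 1))"
proof -
  have "kummerU (a + 1) \<in> O[at_infinity](\<lambda>t. \<bar>t\<bar> powr (- 3 * a))"
    using assms by (intro landau_o.big_trans[OF kummerU_bigo powr_bigo_powr_at_infinity]) auto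
  then have "(\<lambda>t. 3 * (a * (a + 1/3)) * kummerU (a + 1) t - 3 * a * kummerU a t)
      \<in> O[at_infinity](\<lambda>t. \<bar>t\<bar> powr (- 3 * a))"
    using kummerU_bigo[OF assms] by (intro sum_in_bigo) simp_all
  then have "(\<lambda>t. t * deriv (kummerU a) t) \<in> O[at_infinity](\<lambda>t. \<bar>t\<bar> powr (- 3 * a))"
    by (simp only: kummerU_raise)
  then have "(\<lambda>t. inverse t * (t * deriv (kummerU a) t))
      \<in> O[at_infinity](\<lambda>t. inverse t * \<bar>t\<bar> powr (- 3 * a))"
    by (intro landau_o.big.mult_left)
  also have "(\<lambda>t. inverse t * \<bar>t\<bar> powr (- 3 * a))
      \<in> O[at_infinity](\<lambda>t::real. \<bar>t\<bar> powr (- 3 * a - 1))"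
    unfolding at_infinity_eq_at_top_bot by (intro landau_o.big.sup; real_asymp)
  finally show ?thesis
    by (rule landau_o.big.in_cong[THEN iffD1, rotated])
       (auto simp: eventually_at_infinity intro!: exI[of _ 1])
qed

section \<open>Symbol classes\<close>

text \<open>
  \<open>symbol_class n p f\<close>: \<open>f\<close> is \<open>n\<close> times continuously differentiable and its derivative of order
  \<open>j \<le> n\<close> is \<open>O(\<bar>t\<bar> powr (p - j))\<close> at infinity.
\<close>

primrec symbol_class :: "nat \<Rightarrow> real \<Rightarrow> (real \<Rightarrow> real) \<Rightarrow> bool" where
  "symbol_class 0 p f \<longleftrightarrow> continuous_on UNIV f \<and> f \<in> O[at_infinity](\<lambda>t. \<bar>t\<bar> powr p)"
| "symbol_class (Suc n) p f \<longleftrightarrow> f \<in> O[at_infinity](\<lambda>t. \<bar>t\<bar> powr p) \<and>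
     (\<forall>t. (f has_real_derivative deriv f t) (at t)) \<and> symbol_class n (p - 1) (deriv f)"

lemma symbol_class_SucI:
  assumes "f \<in> O[at_infinity](\<lambda>t. \<bar>t\<bar> powr p)" "\<And>t. (f has_real_derivative f' t) (at t)"
    "symbol_class n (p - 1) f'"
  shows "symbol_class (Suc n) p f"
proof -
  have "deriv f = f'" by (intro ext DERIV_imp_deriv assms(2))
  then show ?thesis using assms by simp
qed

lemma symbol_class_deriv: "symbol_class (Suc n) p f \<Longrightarrow> symbol_class n (p - 1) (deriv f)"
  by simp

lemma symbol_class_has_real_derivative:
  "symbol_class (Suc n) p f \<Longrightarrow> (f has_real_derivative deriv f t) (at t)"
  by simp

lemma symbol_class_bigo: "symbol_class n p f \<Longrightarrow> f \<in> O[at_infinity](\<lambda>t. \<bar>t\<bar> powr p)"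
  by (cases n) auto

lemma symbol_class_imp_continuous_on: "symbol_class n p f \<Longrightarrow> continuous_on UNIV f"
  using DERIV_continuous_on[of UNIV f "deriv f"] by (cases n) auto

lemma symbol_class_mono:
  assumes "symbol_class n p f" "p \<le> q"
  shows "symbol_class n q f"
  using assms
proof (induction n arbitrary: f p q)
  case 0
  then show ?case using landau_o.big_trans[OF _ powr_bigo_powr_at_infinity] by auto
next
  case (Suc n)
  then show ?case
    using landau_o.big_trans[OF symbol_class_bigo[OF Suc.prems(1)]
        powr_bigo_powr_at_infinity[OF Suc.prems(2)]]
      Suc.IH[of "p - 1" "deriv f" "q - 1"] by simp
qed

lemma symbol_class_Suc_imp: "symbol_class (Suc n) p f \<Longrightarrow> symbol_class n p f"
proof (induction n arbitrary: f p)
  case 0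
  then show ?case using symbol_class_imp_continuous_on[OF 0] by simp
next
  case (Suc n)
  then show ?case using Suc.IH[of "p - 1" "deriv f"] by simp
qed

lemma symbol_class_add:
  assumes "symbol_class n p f" "symbol_class n p g"
  shows "symbol_class n p (\<lambda>t. f t + g t)"
  using assms
proof (induction n arbitrary: f g p)
  case 0
  then show ?case by (auto intro: continuous_on_add sum_in_bigo)
next
  case (Suc n)
  show ?case
  proof (rule symbol_class_SucI)
    show "(\<lambda>t. f t + g t) \<in> O[at_infinity](\<lambda>t. \<bar>t\<bar> powr p)"
      using Suc.prems by (intro sum_in_bigo symbol_class_bigo)
    show "((\<lambda>t. f t + g t) has_real_derivative deriv f t + deriv g t) (at t)" for t
      using Suc.prems by (intro DERIV_add symbol_class_has_real_derivative)
    show "symbol_class n (p - 1) (\<lambda>t. deriv f t + deriv g t)"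
      using Suc.prems by (intro Suc.IH symbol_class_deriv)
  qed
qed

lemma symbol_class_mult:
  assumes "symbol_class n p f" "symbol_class n q g"
  shows "symbol_class n (p + q) (\<lambda>t. f t * g t)"
  using assms
proof (induction n arbitrary: f g p q)
  case 0
  then show ?case by (auto simp: powr_add intro: continuous_on_mult landau_o.big.mult)
next
  case (Suc n)
  show ?case
  proof (rule symbol_class_SucI)
    show "(\<lambda>t. f t * g t) \<in> O[at_infinity](\<lambda>t. \<bar>t\<bar> powr (p + q))"
      using Suc.prems unfolding powr_add by (intro landau_o.big.mult symbol_class_bigo)
    show "((\<lambda>t. f t * g t) has_real_derivative deriv f t * g t + deriv g t * f t) (at t)" for t
      using Suc.prems by (intro DERIV_mult symbol_class_has_real_derivative)
    have "symbol_class n (p - 1 + q) (\<lambda>t. deriv f t * g t)"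
      "symbol_class n (q - 1 + p) (\<lambda>t. deriv g t * f t)"
      using Suc.prems by (blast intro: Suc.IH symbol_class_deriv symbol_class_Suc_imp)+
    then show "symbol_class n (p + q - 1) (\<lambda>t. deriv f t * g t + deriv g t * f t)"
      by (intro symbol_class_add) (simp_all add: algebra_simps)
  qed
qed

lemma symbol_class_const: "symbol_class n 0 (\<lambda>_. c)"
proof -
  have const_bigo: "(\<lambda>_. c) \<in> O[at_infinity](\<lambda>t::real. \<bar>t\<bar> powr 0)" for c :: real
    by (rule bigoI[where c = "\<bar>c\<bar>"],
        rule eventually_mono[OF eventually_not_equal_at_infinity[of 0]]) simp
  have "symbol_class n p (\<lambda>_. 0)" for n p
    by (induction n arbitrary: p) auto
  then show ?thesis using const_bigo by (cases n) auto
qed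

lemma symbol_class_cmult: "symbol_class n p f \<Longrightarrow> symbol_class n p (\<lambda>t. c * f t)"
  using symbol_class_mult[OF symbol_class_const[of n c]] by fastforce

lemma symbol_class_ident: "symbol_class n 1 (\<lambda>t. t)"
proof -
  have "(\<lambda>t. t) \<in> O[at_infinity](\<lambda>t::real. \<bar>t\<bar> powr 1)"
    by (rule bigoI[where c = 1]) simp
  then show ?thesis
    using symbol_class_const by (cases n) auto
qed

lemma symbol_class_mult_ident: "symbol_class n p f \<Longrightarrow> symbol_class n (p + 1) (\<lambda>t. t * f t)"
  using symbol_class_mult[OF symbol_class_ident, of n p f] by (simp add: add.commute)

lemma has_real_derivative_one_plus_square_powr:
  "((\<lambda>t::real. (1 + t\<^sup>2) powr c) has_real_derivative 2 * c * (t * (1 + t\<^sup>2) powr (c - 1))) (at t)"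
proof -
  have "((\<lambda>t. 1 + t\<^sup>2) has_real_derivative 2 * t) (at t)" by (auto intro!: derivative_eq_intros)
  moreover have "1 + t\<^sup>2 > 0" by (simp add: add_pos_nonneg)
  ultimately show ?thesis using DERIV_fun_powr[of "\<lambda>t. 1 + t\<^sup>2" "2 * t" t c] by (simp add: mult_ac)
qed

lemma one_plus_square_powr_bigo:
  "(\<lambda>t::real. (1 + t\<^sup>2) powr c) \<in> O[at_infinity](\<lambda>t. \<bar>t\<bar> powr (2 * c))"
  unfolding at_infinity_eq_at_top_bot by (intro landau_o.big.sup; real_asymp)

lemma symbol_class_one_plus_square_powr: "symbol_class n (2 * c) (\<lambda>t. (1 + t\<^sup>2) powr c)"
proof (induction n arbitrary: c)
  case 0
  have "continuous_on UNIV (\<lambda>t::real. (1 + t\<^sup>2) powr c)"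
    using has_real_derivative_one_plus_square_powr by (rule DERIV_continuous_on)
  then show ?case using one_plus_square_powr_bigo by simp
next
  case (Suc n)
  have "symbol_class n (2 * c - 1) (\<lambda>t. 2 * c * (t * (1 + t\<^sup>2) powr (c - 1)))"
    using symbol_class_cmult[OF symbol_class_mult_ident[OF Suc[of "c - 1"]], of "2 * c"]
    by (simp add: algebra_simps)
  then show ?case
    by (rule symbol_class_SucI[OF one_plus_square_powr_bigo
          has_real_derivative_one_plus_square_powr])
qed

text \<open>Writing \<open>h = (h + t (t h)) / (1 + t\<^sup>2)\<close> avoids the division by \<open>t\<close> at the origin.\<close>

lemma symbol_class_gain:
  assumes "symbol_class n (p + 1) h" "symbol_class n p (\<lambda>t. t * h t)"
  shows "symbol_class n (p - 1) h"
proof -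
  have "symbol_class n (p + 1) (\<lambda>t. h t + t * (t * h t))"
    using assms by (intro symbol_class_add symbol_class_mult_ident)
  with symbol_class_one_plus_square_powr[of n "-1"]
  have "symbol_class n (2 * (-1) + (p + 1)) (\<lambda>t. (1 + t\<^sup>2) powr (-1) * (h t + t * (t * h t)))"
    by (rule symbol_class_mult)
  moreover have "(1 + t\<^sup>2) powr (-1) * (h t + t * (t * h t)) = h t" for t
  proof -
    have "1 + t\<^sup>2 > 0" by (simp add: add_pos_nonneg)
    then show ?thesis by (simp add: powr_minus field_simps power2_eq_square)
  qed
  ultimately show ?thesis by simp
qed

lemma bounded_range_continuous_bigo_1:
  fixes f :: "'a::{real_normed_vector, heine_borel} \<Rightarrow> real"
  assumes "continuous_on UNIV f" "f \<in> O[at_infinity](\<lambda>_. 1)"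
  shows "bounded (range f)"
proof -
  obtain B where "eventually (\<lambda>x. norm (f x) \<le> B) at_infinity"
    using assms(2) by (auto elim!: landau_o.bigE)
  then obtain R where R: "\<And>x. R \<le> norm x \<Longrightarrow> norm (f x) \<le> B"
    by (auto simp: eventually_at_infinity)
  have "bounded (f ` cball 0 R)"
    using assms(1)
    by (intro compact_imp_bounded compact_continuous_image) (auto intro: continuous_on_subset)
  moreover have "bounded (f ` {x. R \<le> norm x})"
    using R by (auto simp: bounded_iff)
  moreover have "UNIV = cball 0 R \<union> {x :: 'a. R \<le> norm x}"
    by auto
  ultimately show ?thesis by (metis bounded_Un image_Un)
qed

lemma symbol_class_bounded:
  assumes "symbol_class n (- real m) f"
  obtains C where "\<And>t. \<bar>t ^ m * f t\<bar> \<le> C"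
proof -
  have "(\<lambda>t. t ^ m * f t) \<in> O[at_infinity](\<lambda>t. t ^ m * \<bar>t\<bar> powr (- real m))"
    using symbol_class_bigo[OF assms] by (rule landau_o.big.mult_left)
  also have "(\<lambda>t. t ^ m * \<bar>t\<bar> powr (- real m)) \<in> O[at_infinity](\<lambda>_. 1 :: real)"
  proof (rule bigoI[where c = 1])
    have "norm (t ^ m * \<bar>t\<bar> powr (- real m)) \<le> 1" for t :: real
      by (cases "t = 0") (simp_all add: abs_mult power_abs powr_minus powr_realpow field_simps)
    then show "eventually (\<lambda>t. norm (t ^ m * \<bar>t\<bar> powr (- real m)) \<le> 1 * norm (1 :: real)) at_infinity"
      by simp
  qed
  finally have "bounded (range (\<lambda>t. t ^ m * f t))"
    using symbol_class_imp_continuous_on[OF assms]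
    by (intro bounded_range_continuous_bigo_1 continuous_intros)
  then show ?thesis
    using that by (auto simp: bounded_iff)
qed

section \<open>Symbol estimates for \<open>\<Lambda>\<^sub>k\<close>\<close>

lemma symbol_class_kummerU_pos:
  assumes "a > 0"
  shows "symbol_class n (- 3 * a) (kummerU a) \<and> symbol_class n (- 3 * a - 1) (deriv (kummerU a))"
  using assms
proof (induction n arbitrary: a)
  case 0
  have "continuous_on UNIV (kummerU a)" "continuous_on UNIV (deriv (kummerU a))"
    by (rule DERIV_continuous_on,
        rule has_real_derivative_kummerU has_real_derivative_deriv_kummerU)+
  then show ?case using kummerU_bigo[OF 0] deriv_kummerU_bigo[OF 0] by simp
next
  case (Suc n)
  have "symbol_class (Suc n) (- 3 * a) (kummerU a)"
    using Suc by (intro symbol_class_SucI[OF kummerU_bigo has_real_derivative_kummerU]) auto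
  moreover have "symbol_class (Suc n) (- 3 * a - 1) (deriv (kummerU a))"
  proof (rule symbol_class_SucI[OF deriv_kummerU_bigo[OF Suc.prems]
        has_real_derivative_deriv_kummerU])
    have "symbol_class n (- 3 * (a + 1)) (kummerU (a + 1))"
      using Suc.IH[of "a + 1"] Suc.prems by simp
    then have "symbol_class n (- 3 * a - 1 - 1) (\<lambda>t. t * kummerU (a + 1) t)"
      using symbol_class_mult_ident by fastforce
    from symbol_class_cmult[OF this, of "- (a * (a + 1/3))"]
    show "symbol_class n (- 3 * a - 1 - 1) (\<lambda>t. - (a * (a + 1/3)) * t * kummerU (a + 1) t)"
      by (simp only: mult.assoc)
  qed
  ultimately show ?case ..
qed

lemma symbol_class_kummerU: "symbol_class n (- 3 * a) (kummerU a)"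
proof -
  obtain m :: nat where "a > - real m"
    using reals_Archimedean2[of "- a"] by (auto simp: minus_less_iff)
  then show ?thesis
  proof (induction m arbitrary: a n)
    case 0
    then show ?case using symbol_class_kummerU_pos by simp
  next
    case (Suc m)
    have U: "symbol_class n (- 3 * (a + 1)) (kummerU (a + 1))" for n
      using Suc.prems by (intro Suc.IH) simp
    have "symbol_class n (- 3 * (a + 1) + 1 + 1 + 1) (\<lambda>t. t * (t * (t * kummerU (a + 1) t)))"
      by (intro symbol_class_mult_ident U)
    moreover have "symbol_class n (- 3 * (a + 1) - 1 + 1) (\<lambda>t. t * deriv (kummerU (a + 1)) t)"
      by (intro symbol_class_mult_ident symbol_class_deriv U)
    ultimately have "symbol_class n (- 3 * a) (\<lambda>t. (a + 1/3) * kummerU (a + 1) t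
        + ((-1/9) * (t * (t * (t * kummerU (a + 1) t)))
        + (-1/3) * (t * deriv (kummerU (a + 1)) t)))"
      using U[of n] by (intro symbol_class_add symbol_class_cmult) (auto elim!: symbol_class_mono)
    moreover have "(a + 1/3) * kummerU (a + 1) t + ((-1/9) * (t * (t * (t * kummerU (a + 1) t)))
        + (-1/3) * (t * deriv (kummerU (a + 1)) t)) = kummerU a t" for t
      using kummerU_lower[of t a] by (simp add: algebra_simps power3_eq_cube)
    ultimately show ?case by simp
  qed
qed

definition weighted_kummerU :: "real \<Rightarrow> real \<Rightarrow> real" where
  "weighted_kummerU a t = (1 + t\<^sup>2) powr (3 * a / 2) * kummerU a t"

lemma symbol_class_weighted_kummerU: "symbol_class n 0 (weighted_kummerU a)"
  using symbol_class_mult[OF symbol_class_one_plus_square_powr[of n "3 * a / 2"]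
      symbol_class_kummerU[of n a]]
  by (simp add: weighted_kummerU_def[abs_def])

lemma mult_deriv_weighted_kummerU:
  "t * deriv (weighted_kummerU a) t =
    3 * (a * (a + 1/3)) * ((1 + t\<^sup>2) powr (3 * a / 2) * kummerU (a + 1) t)
    - 3 * a * ((1 + t\<^sup>2) powr (3 * a / 2 - 1) * kummerU a t)"
proof -
  define P where "P = (1 + t\<^sup>2) powr (3 * a / 2 - 1)"
  define Q where "Q = (1 + t\<^sup>2) powr (3 * a / 2)"
  have "1 + t\<^sup>2 > 0" by (simp add: add_pos_nonneg)
  then have Q: "Q = P * (1 + t\<^sup>2)"
    using powr_add[of "1 + t\<^sup>2" "3 * a / 2 - 1" 1] by (simp add: P_def Q_def)
  have "(weighted_kummerU a has_real_derivative
      2 * (3 * a / 2) * (t * P) * kummerU a t + deriv (kummerU a) t * Q) (at t)"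
    unfolding weighted_kummerU_def[abs_def] P_def Q_def
    by (intro DERIV_mult has_real_derivative_one_plus_square_powr has_real_derivative_kummerU)
  then have "t * deriv (weighted_kummerU a) t =
      3 * a * t\<^sup>2 * P * kummerU a t + (t * deriv (kummerU a) t) * Q"
    by (simp add: DERIV_imp_deriv power2_eq_square algebra_simps)
  also have "\<dots> = 3 * (a * (a + 1/3)) * (Q * kummerU (a + 1) t) - 3 * a * (P * kummerU a t)"
    unfolding kummerU_raise Q by (simp add: algebra_simps)
  finally show ?thesis by (simp only: P_def Q_def)
qed

lemma symbol_class_deriv_weighted_kummerU: "symbol_class n (- 3) (deriv (weighted_kummerU a))"
proof -
  have "symbol_class n (2 * (3 * a / 2) + - 3 * (a + 1))
      (\<lambda>t. (1 + t\<^sup>2) powr (3 * a / 2) * kummerU (a + 1) t)"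
    "symbol_class n (2 * (3 * a / 2 - 1) + - 3 * a)
      (\<lambda>t. (1 + t\<^sup>2) powr (3 * a / 2 - 1) * kummerU a t)"
    by (intro symbol_class_mult symbol_class_one_plus_square_powr symbol_class_kummerU)+
  then have "symbol_class n (- 2)
      (\<lambda>t. 3 * (a * (a + 1/3)) * ((1 + t\<^sup>2) powr (3 * a / 2) * kummerU (a + 1) t)
      + (- 3 * a) * ((1 + t\<^sup>2) powr (3 * a / 2 - 1) * kummerU a t))"
    by (intro symbol_class_add symbol_class_cmult; elim symbol_class_mono) auto
  then have "symbol_class n (- 2) (\<lambda>t. t * deriv (weighted_kummerU a) t)"
    by (simp add: mult_deriv_weighted_kummerU)
  moreover have "symbol_class n (- 2 + 1) (deriv (weighted_kummerU a))"
    using symbol_class_deriv[OF symbol_class_weighted_kummerU[of "Suc n" a]] by simp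
  ultimately show ?thesis
    using symbol_class_gain by fastforce
qed

lemma kummerU_altdef:
  "kummerU a t = Gamma (1/3) / Gamma (a + 1/3) * kummerM a (2/3) (- (t ^ 3) / 9)
     - t / 9 powr (1/3) * (Gamma (-1/3) / Gamma a) * kummerM (a + 1/3) (4/3) (- (t ^ 3) / 9)"
  unfolding kummerU_def kummerU_init_def kummerU_slope_def kummerP_def kummerQ_def
    rGamma_inverse_Gamma
  by (simp add: inverse_eq_divide)

lemma Lambda_eq_weighted_kummerU:
  "Lambda k = (\<lambda>t. 9 powr (1/6 + real_of_int k) * weighted_kummerU (-1/6 - real_of_int k) t)"
proof -
  have "-1/4 - 3 * real_of_int k / 2 = 3 * (-1/6 - real_of_int k) / 2"
    "1/6 - real_of_int k = -1/6 - real_of_int k + 1/3" by (simp_all add: field_simps)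
  then show ?thesis
    unfolding Lambda_def[abs_def] weighted_kummerU_def kummerU_altdef by (simp only: mult.assoc)
qed

lemma symbol_class_Lambda: "symbol_class n 0 (Lambda k)"
  unfolding Lambda_eq_weighted_kummerU by (intro symbol_class_cmult symbol_class_weighted_kummerU)

lemma symbol_class_deriv_Lambda: "symbol_class n (- 3) (deriv (Lambda k))"
proof -
  have "weighted_kummerU a field_differentiable at t" for a t
    using symbol_class_has_real_derivative[OF symbol_class_weighted_kummerU]
    by (auto simp: field_differentiable_def)
  then have "deriv (Lambda k) =
      (\<lambda>t. 9 powr (1/6 + real_of_int k) * deriv (weighted_kummerU (-1/6 - real_of_int k)) t)"
    unfolding Lambda_eq_weighted_kummerU by (simp add: fun_eq_iff)
  then show ?thesis
    by (simp only:) (intro symbol_class_cmult symbol_class_deriv_weighted_kummerU)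
qed

theorem lemma2p15:
  fixes k :: int
  shows "\<exists>C>0. \<forall>t::real.
     \<bar>Lambda k t\<bar> + \<bar>t^3 * deriv (Lambda k) t\<bar> + \<bar>t^4 * (deriv ^^ 2) (Lambda k) t\<bar>
       + \<bar>t^5 * (deriv ^^ 3) (Lambda k) t\<bar> \<le> C"
proof -
  have deriv1: "symbol_class 2 (- real 3) (deriv (Lambda k))"
    using symbol_class_deriv_Lambda by simp
  then have deriv2: "symbol_class 1 (- real 4) ((deriv ^^ 2) (Lambda k))"
    using symbol_class_deriv[of 1] by (simp add: numeral_2_eq_2)
  then have deriv3: "symbol_class 0 (- real 5) ((deriv ^^ 3) (Lambda k))"
    using symbol_class_deriv[of 0] by (simp add: numeral_2_eq_2 numeral_3_eq_3)
  obtain C0 where C0: "\<And>t. \<bar>Lambda k t\<bar> \<le> C0"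
    using symbol_class_bounded[of 0 0 "Lambda k"] symbol_class_Lambda by auto
  obtain C1 where C1: "\<And>t. \<bar>t ^ 3 * deriv (Lambda k) t\<bar> \<le> C1"
    using symbol_class_bounded[OF deriv1] by blast
  obtain C2 where C2: "\<And>t. \<bar>t ^ 4 * (deriv ^^ 2) (Lambda k) t\<bar> \<le> C2"
    using symbol_class_bounded[OF deriv2] by blast
  obtain C3 where C3: "\<And>t. \<bar>t ^ 5 * (deriv ^^ 3) (Lambda k) t\<bar> \<le> C3"
    using symbol_class_bounded[OF deriv3] by blast
  have "\<bar>Lambda k t\<bar> + \<bar>t^3 * deriv (Lambda k) t\<bar> + \<bar>t^4 * (deriv ^^ 2) (Lambda k) t\<bar>
       + \<bar>t^5 * (deriv ^^ 3) (Lambda k) t\<bar> \<le> max 1 (C0 + C1 + C2 + C3)" for t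
    using C0[of t] C1[of t] C2[of t] C3[of t] by linarith
  then show ?thesis by (intro exI[of _ "max 1 (C0 + C1 + C2 + C3)"]) simp
qed

end
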